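(* Let $p(\cdot):G\to[1,\infty)$ be a measurable function with $1<p_-\le p_+<\infty$. Then the following statements are equivalent: (i) the maximal operator $M$ is bounded on $L^{p(\cdot)}(G)$; (ii) there exists $r_0$, $0<r_0<1$, such that if $r_0<r<1$, then the maximal operator $M$ is bounded on $L^{rp(\cdot)}(G)$.
   Context: Group. Let $\{p_i\}_{i\ge0}$ be a sequence of integers with $p_i\ge2$ (no boundedness is assumed), $G=\prod_{i=0}^\infty\mathbb{Z}_{p_i}$ the direct product of cyclic groups of order $p_i$, and $\mu$ the Haar measure on $G$ normalized by $\mu(G)=1$. Elements of $G$ are sequences $x=\{x_i\}$ with $0\le x_i<p_i$; addition is coordinatewise modulo $p_i$. Generalized intervals. $\mathcal{F}$ is the collection of all sets of the form $x+\{y\in G: y_i=0 \text{ for } i<k,\ 0\le y_k<j\}$ with $x\in G$, $k\ge0$, $1\le j\le p_k$. Maximal function. $Mf(x)=\sup_{x\in I,\,I\in\mathcal{F}}\frac{1}{\mu(I)}\int_I|f|\,d\mu\in[0,\infty]$. Variable Lebesgue space. For a measurable $q(\cdot):G\to(0,\infty)$, $L^{q(\cdot)}(G)$ is the set of measurable $f$ such that $\int_G(|f(x)|/\lambda)^{q(x)}d\mu<\infty$ for some $\lambda>0$, with $\|f\|_{q(\cdot)}=\inf\{\lambda>0:\int_G(|f(x)|/\lambda)^{q(x)}d\mu\le1\}$ (a norm when $q(\cdot)\ge1$). Write $p_-=\operatorname{ess\,inf}_{x\in G}p(x)$, $p_+=\operatorname{ess\,sup}_{x\in G}p(x)$. The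 exponent $rp(\cdot)$ is the function $x\mapsto r\,p(x)$. $M$ is bounded on $L^{q(\cdot)}(G)$ if there is a constant $C$ (which may depend on $q(\cdot)$) with $\|Mf\|_{q(\cdot)}\le C\|f\|_{q(\cdot)}$ for all $f\in L^{q(\cdot)}(G)$. *)

theory Defs
  imports "HOL-Probability.Probability" "HOL-Algebra.Product_Groups" "HOL-Algebra.Coset"
begin

definition vgroup :: "(nat \<Rightarrow> nat) \<Rightarrow> (nat \<Rightarrow> int) monoid" where
  "vgroup P = product_group UNIV (\<lambda>i. integer_mod_group (P i))"

text \<open>The type \<^typ>\<open>nat \<Rightarrow> int\<close> carries the product topology of the discrete
  spaces \<^typ>\<open>int\<close>, so restricting its Borel sets to the carrier gives the Borel sets of the
  compact group \<open>\<Prod>\<^sub>i \<int>\<^sub>P\<^sub>i\<close>.  The Haar measure is completed: a measurable function may be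
  modified arbitrarily on a null set.\<close>

definition normalized_haar :: "(nat \<Rightarrow> nat) \<Rightarrow> (nat \<Rightarrow> int) measure \<Rightarrow> bool" where
  "normalized_haar P \<mu> \<longleftrightarrow>
     (\<exists>\<nu>. \<mu> = completion \<nu> \<and>
          sets \<nu> = sets (restrict_space borel (carrier (vgroup P))) \<and>
          emeasure \<nu> (carrier (vgroup P)) = 1 \<and>
          (\<forall>x\<in>carrier (vgroup P). \<forall>A\<in>sets \<nu>.
             emeasure \<nu> (x <#\<^bsub>vgroup P\<^esub> A) = emeasure \<nu> A))"

definition gen_intervals :: "(nat \<Rightarrow> nat) \<Rightarrow> (nat \<Rightarrow> int) set set" where
  "gen_intervals P =
     {x <#\<^bsub>vgroup P\<^esub> {y \<in> carrier (vgroup P). (\<forall>i<k. y i = 0) \<and> 0 \<le> y k \<and> y k < int j} | x k j.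
        x \<in> carrier (vgroup P) \<and> 1 \<le> j \<and> j \<le> P k}"

definition maximal_fun ::
  "(nat \<Rightarrow> nat) \<Rightarrow> (nat \<Rightarrow> int) measure \<Rightarrow> ((nat \<Rightarrow> int) \<Rightarrow> real) \<Rightarrow> (nat \<Rightarrow> int) \<Rightarrow> ennreal" where
  "maximal_fun P \<mu> f x =
     (SUP I \<in> {I \<in> gen_intervals P. x \<in> I}. (\<integral>\<^sup>+y\<in>I. ennreal \<bar>f y\<bar> \<partial>\<mu>) / emeasure \<mu> I)"

text \<open>Maximal functions may take the value \<open>\<infinity>\<close>, so modular and norm are defined on
  functions with values in \<open>[0, \<infinity>]\<close>; a real function \<open>f\<close> enters through \<open>|f|\<close>.
  The power below is only used for exponents \<open>a > 0\<close>.\<close>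

definition ennreal_powr :: "ennreal \<Rightarrow> real \<Rightarrow> ennreal" where
  "ennreal_powr c a = (if c = \<top> then \<top> else ennreal (enn2real c powr a))"

definition var_modular :: "'a measure \<Rightarrow> ('a \<Rightarrow> real) \<Rightarrow> ('a \<Rightarrow> ennreal) \<Rightarrow> ennreal" where
  "var_modular \<mu> q g = (\<integral>\<^sup>+x. ennreal_powr (g x) (q x) \<partial>\<mu>)"

definition var_norm :: "'a measure \<Rightarrow> ('a \<Rightarrow> real) \<Rightarrow> ('a \<Rightarrow> ennreal) \<Rightarrow> ennreal" where
  "var_norm \<mu> q g =
     Inf (ennreal ` {t. 0 < t \<and> var_modular \<mu> q (\<lambda>x. g x / ennreal t) \<le> 1})"

definition var_Lebesgue :: "'a measure \<Rightarrow> ('a \<Rightarrow> real) \<Rightarrow> ('a \<Rightarrow> real) set" where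
  "var_Lebesgue \<mu> q =
     {f \<in> borel_measurable \<mu>.
        \<exists>t>0. var_modular \<mu> q (\<lambda>x. ennreal \<bar>f x\<bar> / ennreal t) < \<infinity>}"

definition maximal_bounded_on ::
  "(nat \<Rightarrow> nat) \<Rightarrow> (nat \<Rightarrow> int) measure \<Rightarrow> ((nat \<Rightarrow> int) \<Rightarrow> real) \<Rightarrow> bool" where
  "maximal_bounded_on P \<mu> q \<longleftrightarrow>
     (\<exists>C::real. \<forall>f \<in> var_Lebesgue \<mu> q.
        var_norm \<mu> q (maximal_fun P \<mu> f) \<le> ennreal C * var_norm \<mu> q (\<lambda>x. ennreal \<bar>f x\<bar>))"

definition essinf :: "'a measure \<Rightarrow> ('a \<Rightarrow> ereal) \<Rightarrow> ereal" where
  "essinf \<mu> f = - esssup \<mu> (\<lambda>x. - f x)"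

instance int :: second_countable_topology
proof
  let ?B = "range (\<lambda>i::int. {i})"
  have "generate_topology ?B S" for S :: "int set"
  proof -
    have "generate_topology ?B (\<Union>x\<in>S. {x})"
      by (rule generate_topology_Union) (auto intro: generate_topology.Basis)
    then show ?thesis by simp
  qed
  then have "open = generate_topology ?B" by (intro ext) (simp add: Topological_Spaces.open_discrete)
  then show "\<exists>B::int set set. countable B \<and> open = generate_topology B"
    by (intro exI[of _ ?B]) auto
qed

lemma carrier_vgroup:
  assumes "\<And>i. 2 \<le> P i"
  shows "carrier (vgroup P) = {x. \<forall>i. 0 \<le> x i \<and> x i < int (P i)}"
proof -
  have "P i \<noteq> 0" for i using assms[of i] by linarith
  then show ?thesis
    by (auto simp: vgroup_def carrier_integer_mod_group PiE_def Pi_def)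
qed

lemma mult_vgroup: "x \<otimes>\<^bsub>vgroup P\<^esub> y = (\<lambda>i. (x i + y i) mod int (P i))"
  by (simp add: vgroup_def product_group_def restrict_def)

lemma group_vgroup: "group (vgroup P)"
  unfolding vgroup_def by (rule product_group) simp

lemma normalized_haar_exists:
  fixes P :: "nat \<Rightarrow> nat"
  assumes P: "\<And>i. 2 \<le> P i"
  shows "\<exists>\<mu>. normalized_haar P \<mu>"
proof -
  define U where "U i = measure_pmf (pmf_of_set {0..<int (P i)})" for i
  define N where "N = PiM UNIV U"
  let ?G = "carrier (vgroup P)"
  have P0: "0 < P i" for i using P[of i] by linarith
  have ps: "prob_space (U i)" for i unfolding U_def by (rule prob_space_measure_pmf)
  interpret PP: product_prob_space U UNIV
    by (intro product_prob_spaceI ps)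
  have sU: "sets (U i) = sets borel" for i
    by (auto simp: U_def sets_borel_eq_count_space)
  have spU: "space (U i) = UNIV" for i by (simp add: U_def)
  have sN: "sets N = sets borel"
  proof -
    have "sets N = sets (PiM UNIV (\<lambda>i::nat. borel :: int measure))"
      unfolding N_def by (intro sets_PiM_cong refl sU)
    then show ?thesis by (simp add: sets_PiM_equal_borel)
  qed
  have spN: "space N = UNIV" by (simp add: N_def space_PiM spU)
  have comp: "(\<lambda>x. x i) \<in> measurable N (U i)" for i
    unfolding N_def by (rule measurable_component_singleton) simp
  have Gm: "?G \<in> sets N"
  proof -
    have "?G = (\<Inter>i. (\<lambda>x. x i) -` {0..<int (P i)} \<inter> space N)"
      by (auto simp: carrier_vgroup[OF P] spN)
    also have "\<dots> \<in> sets N"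
    proof (rule sets.countable_INT'')
      show "UNIV \<in> sets N" using sets.top[of N] by (simp add: spN)
      show "(\<lambda>x. x i) -` {0..<int (P i)} \<inter> space N \<in> sets N" for i
        by (rule measurable_sets[OF comp]) (simp add: U_def)
    qed simp
    finally show ?thesis .
  qed
  have G1: "AE x in N. x \<in> ?G"
  proof -
    have "AE x in N. x i \<in> {0..<int (P i)}" for i
    proof -
      have "AE y in U i. y \<in> {0..<int (P i)}"
        unfolding U_def using P0[of i] by (auto intro!: AE_pmfI)
      then show ?thesis unfolding N_def
        by (rule AE_PiM_component[OF ps, rotated]) simp
    qed
    then have "AE x in N. \<forall>i. x i \<in> {0..<int (P i)}" by (simp add: AE_all_countable)
    then show ?thesis by (auto simp: carrier_vgroup[OF P])
  qed
  have pN: "prob_space N" unfolding N_def by (rule prob_space_PiM[OF ps])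
  have inv: "distr N N (\<lambda>y i. (x i + y i) mod int (P i)) = N" if "x \<in> ?G" for x
  proof -
    define T where "T = (\<lambda>i y. (x i + y) mod int (P i))"
    have Tm: "(\<lambda>y i. T i (y i)) \<in> measurable N N"
    proof -
      have "(\<lambda>y. \<lambda>i\<in>UNIV. T i (y i)) \<in> measurable N (PiM UNIV U)"
      proof (rule measurable_restrict)
        fix i :: nat
        have "(\<lambda>y. y i) \<in> measurable N (U i)" by (rule comp)
        moreover have "T i \<in> measurable (U i) (U i)" by (simp add: U_def)
        ultimately show "(\<lambda>y. T i (y i)) \<in> measurable N (U i)"
          by (rule measurable_compose)
      qed
      then show ?thesis by (simp add: N_def restrict_def)
    qed
    have TU: "distr (U i) (U i) (T i) = U i" for i
    proof -
      have inj: "inj_on (T i) {0..<int (P i)}"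
      proof (rule inj_onI)
        fix a b assume ab: "a \<in> {0..<int (P i)}" "b \<in> {0..<int (P i)}" "T i a = T i b"
        then have "(x i + a) mod int (P i) = (x i + b) mod int (P i)" by (simp add: T_def)
        then have "(x i + a - x i) mod int (P i) = (x i + b - x i) mod int (P i)"
          by (rule mod_diff_cong) simp
        then show "a = b" using ab by simp
      qed
      have "T i ` {0..<int (P i)} \<subseteq> {0..<int (P i)}"
        using P0[of i] by (auto simp: T_def)
      then have im: "T i ` {0..<int (P i)} = {0..<int (P i)}"
        by (rule endo_inj_surj[rotated 1]) (use inj in auto)
      have "map_pmf (T i) (pmf_of_set {0..<int (P i)}) = pmf_of_set {0..<int (P i)}"
        using map_pmf_of_set_inj[OF inj] P0[of i] im by auto
      moreover have "distr (U i) (U i) (T i) = measure_pmf (map_pmf (T i) (pmf_of_set {0..<int (P i)}))"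
        unfolding U_def map_pmf_rep_eq by (rule distr_cong) auto
      ultimately show ?thesis by (simp add: U_def)
    qed
    have "distr N N (\<lambda>y i. T i (y i)) = PiM UNIV U"
    proof (rule PP.PiM_eq)
      show "sets (distr N N (\<lambda>y i. T i (y i))) = sets (PiM UNIV U)" by (simp add: N_def)
    next
      fix J A assume J: "finite J" "J \<subseteq> UNIV" "\<And>j. j \<in> J \<Longrightarrow> A j \<in> sets (U j)"
      have A': "T j -` A j \<in> sets (U j)" for j by (simp add: U_def)
      have mm: "prod_emb UNIV U J (Pi\<^sub>E J A) \<in> sets N"
        unfolding N_def using J by (intro sets_PiM_I) auto
      have "emeasure (distr N N (\<lambda>y i. T i (y i))) (prod_emb UNIV U J (Pi\<^sub>E J A)) =
            emeasure N ((\<lambda>y i. T i (y i)) -` prod_emb UNIV U J (Pi\<^sub>E J A) \<inter> space N)"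
        by (rule emeasure_distr[OF Tm mm])
      also have "(\<lambda>y i. T i (y i)) -` prod_emb UNIV U J (Pi\<^sub>E J A) \<inter> space N =
                 prod_emb UNIV U J (Pi\<^sub>E J (\<lambda>j. T j -` A j))"
        by (auto simp: prod_emb_def spN spU PiE_def Pi_def restrict_def extensional_def)
      also have "emeasure N \<dots> = (\<Prod>j\<in>J. emeasure (U j) (T j -` A j))"
        unfolding N_def by (rule PP.emeasure_PiM_emb) (use J A' in auto)
      also have "\<dots> = (\<Prod>j\<in>J. emeasure (U j) (A j))"
      proof (rule prod.cong[OF refl])
        fix j assume "j \<in> J"
        have "emeasure (distr (U j) (U j) (T j)) (A j) = emeasure (U j) (T j -` A j \<inter> space (U j))"
          by (rule emeasure_distr) (simp_all add: U_def)
        then show "emeasure (U j) (T j -` A j) = emeasure (U j) (A j)" by (simp add: TU spU)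
      qed
      finally show "emeasure (distr N N (\<lambda>y i. T i (y i))) (prod_emb UNIV U J (Pi\<^sub>E J A)) =
         (\<Prod>j\<in>J. emeasure (U j) (A j))" .
    qed
    then show ?thesis by (simp add: N_def T_def)
  qed
  have Tm: "(\<lambda>y i. (x i + y i) mod int (P i)) \<in> measurable N N" for x :: "nat \<Rightarrow> int"
  proof -
    have "(\<lambda>y. \<lambda>i\<in>UNIV. (x i + y i) mod int (P i)) \<in> measurable N (PiM UNIV U)"
    proof (rule measurable_restrict)
      fix i :: nat
      have "(\<lambda>y. y i) \<in> measurable N (U i)" by (rule comp)
      moreover have "(\<lambda>y. (x i + y) mod int (P i)) \<in> measurable (U i) (U i)" by (simp add: U_def)
      ultimately show "(\<lambda>y. (x i + y i) mod int (P i)) \<in> measurable N (U i)"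
        by (rule measurable_compose)
    qed
    then show ?thesis by (simp add: N_def restrict_def)
  qed
  define \<nu> where "\<nu> = restrict_space N ?G"
  have s\<nu>: "sets \<nu> = sets (restrict_space borel ?G)"
    unfolding \<nu>_def by (rule sets_restrict_space_cong[OF sN])
  have e\<nu>: "emeasure \<nu> A = emeasure N A" if "A \<subseteq> ?G" for A
    unfolding \<nu>_def by (rule emeasure_restrict_space) (use that Gm spN in auto)
  have "emeasure \<nu> ?G = 1"
    using prob_space.emeasure_eq_1_AE[OF pN Gm G1] by (simp add: e\<nu>)
  moreover have "emeasure \<nu> (x <#\<^bsub>vgroup P\<^esub> A) = emeasure \<nu> A"
    if x: "x \<in> ?G" and A: "A \<in> sets \<nu>" for x A
  proof -
    interpret V: group "vgroup P" by (rule group_vgroup)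
    have AG: "A \<subseteq> ?G" and AN: "A \<in> sets N"
      using A Gm by (auto simp: \<nu>_def sets_restrict_space_iff spN)
    define z where "z = inv\<^bsub>vgroup P\<^esub> x"
    have z: "z \<in> ?G" using x by (simp add: z_def)
    define T where "T = (\<lambda>y i. (z i + y i) mod int (P i))"
    have Teq: "T y = z \<otimes>\<^bsub>vgroup P\<^esub> y" for y by (simp add: T_def mult_vgroup)
    have sub: "x <#\<^bsub>vgroup P\<^esub> A \<subseteq> ?G" by (rule V.l_coset_subset_G[OF AG x])
    have eq: "x <#\<^bsub>vgroup P\<^esub> A = T -` A \<inter> ?G"
    proof (intro equalityI subsetI)
      fix w assume "w \<in> x <#\<^bsub>vgroup P\<^esub> A"
      then obtain a where a: "a \<in> A" "w = x \<otimes>\<^bsub>vgroup P\<^esub> a" by (auto simp: l_coset_def)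
      with AG x z have "T w = a" "w \<in> ?G"
        by (auto simp: Teq z_def V.m_assoc[symmetric])
      then show "w \<in> T -` A \<inter> ?G" using a by simp
    next
      fix w assume w: "w \<in> T -` A \<inter> ?G"
      then have "w = x \<otimes>\<^bsub>vgroup P\<^esub> T w" using x
        by (simp add: Teq z_def V.m_assoc[symmetric])
      then show "w \<in> x <#\<^bsub>vgroup P\<^esub> A" using w by (auto simp: l_coset_def)
    qed
    have TA: "T -` A \<in> sets N"
      using measurable_sets[OF Tm[of z] AN] by (simp add: spN T_def)
    have "emeasure N A = emeasure (distr N N T) A" using inv[OF z] by (simp add: T_def)
    also have "\<dots> = emeasure N (T -` A)"
      using emeasure_distr[OF Tm[of z] AN] by (simp add: T_def spN)
    also have "\<dots> = emeasure N (T -` A \<inter> ?G)"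
      by (rule emeasure_eq_AE) (use G1 TA Gm in auto)
    finally show ?thesis using eq sub AG by (simp add: e\<nu>)
  qed
  ultimately show ?thesis
    unfolding normalized_haar_def using s\<nu> by blast
qed

end

theory Submission
  imports Defs
begin

text \<open>
  Replacing \<open>f\<close> by \<open>|f|\<^sup>r\<close> turns boundedness of \<open>M\<close> on \<open>L\<^sup>r\<^sup>p\<close> into boundedness of
  \<open>M\<^sub>s g = M(g\<^sup>s)\<^sup>1\<^sup>/\<^sup>s\<close>, \<open>s = 1/r\<close>, on \<open>L\<^sup>p\<close>.  As \<open>M g \<le> 2 M\<^sub>s g\<close>, (ii) implies (i).
  Conversely, if \<open>M\<close> has norm at most \<open>A\<close> on \<open>L\<^sup>p\<close>, the Rubio de Francia iteration
  \<open>w = \<Sum>\<^sub>k M\<^sup>k g / (4A)\<^sup>k\<close> dominates \<open>g\<close>, has comparable norm, and is an \<open>A\<^sub>1\<close> weight: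
  \<open>M w \<le> 4A w\<close>.  Every generalized interval splits into two generalized intervals each
  having at least a third of its measure.  The maximal function along the resulting
  binary tree gives \<open>A\<^sub>1\<close> weights a reverse Hoelder inequality with exponent \<open>1 + \<delta>\<close> and
  constant depending on \<open>A\<close> only, hence \<open>M\<^sub>s g \<le> C w\<close> for \<open>s \<le> 1 + \<delta>\<close>, which is (ii).
\<close>

text \<open>The obstacle is that the orders \<open>P k\<close> are unbounded: a coset of one level
  may be arbitrarily small inside a coset of the previous level, so a stopping-time proof along
  cosets would give constants depending on \<open>P\<close>. Halving arcs removes this dependence.
  Instead of stopping times, one energy inequality is carried down the tree by induction on depth,
  for maximal functions cut off at that depth. The cutoff keeps their integrals finite, so a small
  multiple of the left-hand side can be absorbed; the passage to the limit comes last. The condition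
  \<open>6 * K * \<delta> \<le> 1\<close> comes from this absorption: the energy inequality costs
  \<open>3 * \<delta>\<close>, domination by the weight costs \<open>K\<close>, and 2 leaves half of
  the left-hand side. With \<open>K = 4 * A\<close> it reads
  \<open>24 * A * \<delta> \<le> 1\<close>, which determines \<open>r0\<close> through
  \<open>r = 1 / (1 + \<delta>)\<close>. The exponent \<open>r * p\<close> may take values below
  one, where convexity fails. The iteration is therefore run with exponent \<open>p\<close> only,
  and \<open>r * p\<close> is reached by substituting powers.\<close>

hide_const (open) Order.top

section \<open>Powers and modulars\<close>

lemma ennreal_powr_ennreal: "0 \<le> x \<Longrightarrow> ennreal_powr (ennreal x) a = ennreal (x powr a)"
  by (simp add: ennreal_powr_def)

lemma ennreal_powr_0 [simp]: "ennreal_powr 0 a = 0"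
  by (simp add: ennreal_powr_def)

lemma ennreal_powr_top [simp]: "ennreal_powr top a = top"
  by (simp add: ennreal_powr_def)

lemma ennreal_powr_eq_top_iff [simp]: "ennreal_powr c a = top \<longleftrightarrow> c = top"
  by (simp add: ennreal_powr_def)

lemma ennreal_powr_one [simp]: "ennreal_powr c 1 = c"
  by (cases c) (simp_all add: ennreal_powr_def)

lemma ennreal_powr_mono: "0 \<le> a \<Longrightarrow> c \<le> d \<Longrightarrow> ennreal_powr c a \<le> ennreal_powr d a"
  by (cases c; cases d) (auto simp: ennreal_powr_ennreal top_unique intro!: ennreal_leI powr_mono2)

lemma ennreal_powr_powr: "ennreal_powr (ennreal_powr c a) b = ennreal_powr c (a * b)"
  by (cases c) (simp_all add: ennreal_powr_ennreal powr_powr)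

lemma ennreal_powr_mult:
  "0 < a \<Longrightarrow> ennreal_powr (c * d) a = ennreal_powr c a * ennreal_powr d a"
  by (cases c; cases d)
     (auto simp: ennreal_powr_ennreal ennreal_mult_top ennreal_top_mult powr_mult
       simp flip: ennreal_mult)

text \<open>The power \<open>a\<close> is an order isomorphism of the extended half-line with
  inverse power \<open>1 / a\<close>, so monotonicity alone suffices and the index set is
  arbitrary.\<close>

lemma ennreal_powr_SUP:
  assumes "0 < a"
  shows "ennreal_powr (SUP i\<in>I. f i) a \<le> (SUP i\<in>I. ennreal_powr (f i) a)"
proof -
  have "f i \<le> ennreal_powr (SUP i\<in>I. ennreal_powr (f i) a) (1 / a)" if "i \<in> I" for i
  proof -
    have "ennreal_powr (ennreal_powr (f i) a) (1 / a)
        \<le> ennreal_powr (SUP i\<in>I. ennreal_powr (f i) a) (1 / a)"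
      using assms that by (intro ennreal_powr_mono SUP_upper) auto
    then show ?thesis using assms by (simp add: ennreal_powr_powr)
  qed
  then have "(SUP i\<in>I. f i) \<le> ennreal_powr (SUP i\<in>I. ennreal_powr (f i) a) (1 / a)"
    by (rule SUP_least)
  then have "ennreal_powr (SUP i\<in>I. f i) a
      \<le> ennreal_powr (ennreal_powr (SUP i\<in>I. ennreal_powr (f i) a) (1 / a)) a"
    using assms by (intro ennreal_powr_mono) auto
  then show ?thesis using assms by (simp add: ennreal_powr_powr)
qed

lemma measurable_ennreal_powr [measurable]:
  assumes [measurable]: "f \<in> borel_measurable M" "q \<in> borel_measurable M"
  shows "(\<lambda>x. ennreal_powr (f x) (q x)) \<in> borel_measurable M"
  unfolding ennreal_powr_def by measurable

section \<open>Modulars and the Luxemburg norm\<close>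

lemma var_modular_mono:
  assumes "\<And>x. x \<in> space M \<Longrightarrow> 0 \<le> q x" "\<And>x. x \<in> space M \<Longrightarrow> f x \<le> g x"
  shows "var_modular M q f \<le> var_modular M q g"
  unfolding var_modular_def by (intro nn_integral_mono ennreal_powr_mono assms)

lemma var_modular_cong_AE:
  assumes "AE x in M. f x = g x"
  shows "var_modular M q f = var_modular M q g"
  unfolding var_modular_def by (rule nn_integral_cong_AE) (use assms in auto)

text \<open>Rests on \<open>\<theta> powr q \<le> \<theta>\<close> for exponents at least one. This
  convexity makes the modulars of the weighted iterates in \<open>rubio_de_francia\<close>
  summable.\<close>

lemma var_modular_contract:
  assumes "\<And>x. x \<in> space M \<Longrightarrow> 1 \<le> q x" "0 \<le> \<theta>" "\<theta> \<le> 1"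
    and [measurable]: "f \<in> borel_measurable M" "q \<in> borel_measurable M"
  shows "var_modular M q (\<lambda>x. ennreal \<theta> * f x) \<le> ennreal \<theta> * var_modular M q f"
proof -
  have "ennreal_powr (ennreal \<theta> * f x) (q x) \<le> ennreal \<theta> * ennreal_powr (f x) (q x)"
    if "x \<in> space M" for x
  proof -
    have "\<theta> powr q x \<le> \<theta> powr 1"
      using assms(1)[OF that] assms(2,3) by (intro powr_mono') auto
    then show ?thesis
      using assms(1)[OF that] assms(2)
      by (subst ennreal_powr_mult) (auto simp: ennreal_powr_ennreal intro!: mult_right_mono ennreal_leI)
  qed
  then have "var_modular M q (\<lambda>x. ennreal \<theta> * f x)
      \<le> (\<integral>\<^sup>+x. ennreal \<theta> * ennreal_powr (f x) (q x) \<partial>M)"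
    unfolding var_modular_def by (rule nn_integral_mono)
  also have "\<dots> = ennreal \<theta> * var_modular M q f"
    unfolding var_modular_def by (rule nn_integral_cmult) measurable
  finally show ?thesis .
qed

lemma var_modular_finite_AE:
  assumes [measurable]: "f \<in> borel_measurable M" "q \<in> borel_measurable M"
    and "0 < t" "var_modular M q (\<lambda>x. f x / ennreal t) \<le> 1"
  shows "AE x in M. f x \<noteq> top"
proof -
  have "(\<integral>\<^sup>+x. ennreal_powr (f x / ennreal t) (q x) \<partial>M) \<noteq> \<infinity>"
    using assms(4) unfolding var_modular_def by (auto simp: top_unique)
  then have "AE x in M. ennreal_powr (f x / ennreal t) (q x) \<noteq> \<infinity>"
    by (intro nn_integral_PInf_AE) measurable
  then show ?thesis
    by eventually_elim (auto simp: ennreal_top_divide)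
qed

lemma ennreal_divide_one [simp]: "c / 1 = (c :: ennreal)"
  by (simp add: divide_ennreal_def)

lemma var_norm_le:
  assumes "0 < t" "var_modular M q (\<lambda>x. g x / ennreal t) \<le> 1"
  shows "var_norm M q g \<le> ennreal t"
  unfolding var_norm_def by (rule Inf_lower) (use assms in auto)

lemma ennreal_divide_left_mono:
  assumes "0 < s" "s \<le> t"
  shows "c / ennreal t \<le> c / ennreal s"
proof -
  have "inverse (ennreal t) \<le> inverse (ennreal s)"
    using assms by (simp add: inverse_ennreal le_imp_inverse_le)
  then show ?thesis by (simp add: divide_ennreal_def mult_left_mono)
qed

text \<open>The strict inequality provides an admissible value below \<open>t\<close>, so it need
  not be shown that the infimum is attained. The price is a doubled constant later.\<close>

lemma var_norm_less_imp_modular: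
  assumes "\<And>x. x \<in> space M \<Longrightarrow> 0 \<le> q x" "var_norm M q g < ennreal t"
  shows "var_modular M q (\<lambda>x. g x / ennreal t) \<le> 1"
proof -
  obtain t' where t': "0 < t'" "var_modular M q (\<lambda>x. g x / ennreal t') \<le> 1" "ennreal t' < ennreal t"
    using assms(2) unfolding var_norm_def by (auto simp: Inf_less_iff)
  have "var_modular M q (\<lambda>x. g x / ennreal t) \<le> var_modular M q (\<lambda>x. g x / ennreal t')"
    using assms(1) t' by (intro var_modular_mono ennreal_divide_left_mono) (auto simp: ennreal_less_iff)
  with t' show ?thesis by simp
qed

section \<open>\<open>A\<^sub>1\<close> weights on binary partitions\<close>

text \<open>A discrete form of \<open>b d(b powr \<delta>) = \<delta> / (1 + \<delta>) d(b powr (1 +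
  \<delta>))\<close>; the factor 3 pays for a jump from \<open>a\<close> to at most
  \<open>3 * a\<close>. The increment of the power is bounded by Young's inequality
  \<open>x powr \<delta> \<le> 1 + \<delta> * (x - 1)\<close> with \<open>x = b / a\<close>.\<close>

lemma powr_increment_bound:
  fixes a b \<delta> :: real
  assumes "0 < \<delta>" "\<delta> \<le> 1" "0 \<le> a" "a \<le> b" "b \<le> 3 * a"
  shows "(b powr \<delta> - a powr \<delta>) * b \<le> 3 * \<delta> * (b powr (1 + \<delta>) - a powr (1 + \<delta>))"
proof (cases "a = 0")
  case True
  then show ?thesis using assms by simp
next
  case False
  then have a: "0 < a" and b: "0 < b" using assms by auto
  define x where "x = b / a"
  have x: "0 < x" "b = a * x" using a b by (simp_all add: x_def)
  have "x powr \<delta> \<le> 1 + \<delta> * (x - 1)"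
    using Youngs_inequality_0[of \<delta> "1 - \<delta>" x 1] assms(1,2) x(1) by (simp add: right_diff_distrib)
  then have "a powr \<delta> * x powr \<delta> \<le> a powr \<delta> * (1 + \<delta> * (x - 1))"
    by (rule mult_left_mono) simp
  then have *: "b powr \<delta> - a powr \<delta> \<le> a powr \<delta> * \<delta> * (x - 1)"
    using a x by (simp add: powr_mult algebra_simps)
  have "b powr \<delta> - a powr \<delta> \<ge> 0" using assms powr_mono2[of \<delta> a b] by simp
  then have "(b powr \<delta> - a powr \<delta>) * b \<le> (a powr \<delta> * \<delta> * (x - 1)) * (3 * a)"
    using * assms b by (intro mult_mono) linarith+
  also have "\<dots> = 3 * \<delta> * (a powr \<delta> * (b - a))"
    by (simp add: x(2) algebra_simps)
  also have "\<dots> \<le> 3 * \<delta> * (b powr (1 + \<delta>) - a powr (1 + \<delta>))"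
  proof -
    have "a powr \<delta> * b \<le> b powr \<delta> * b"
      using assms by (intro mult_right_mono powr_mono2) auto
    then have "a powr \<delta> * (b - a) \<le> b powr (1 + \<delta>) - a powr (1 + \<delta>)"
      using a b by (simp add: powr_add algebra_simps)
    then show ?thesis using assms by (intro mult_left_mono) auto
  qed
  finally show ?thesis .
qed

text \<open>The tree lives on labels rather than on sets, because one set may carry several labels:
  for arcs, a coset is both a short arc of its level and a full arc of the next.\<close>

locale binary_partition =
  fixes M :: "'a measure" and V :: "'t set" and D :: "'t \<Rightarrow> 'a set" and L R :: "'t \<Rightarrow> 't"
  assumes L_in: "t \<in> V \<Longrightarrow> L t \<in> V"
    and R_in: "t \<in> V \<Longrightarrow> R t \<in> V"
    and sets_D: "t \<in> V \<Longrightarrow> D t \<in> sets M"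
    and D_finite: "t \<in> V \<Longrightarrow> emeasure M (D t) \<noteq> top"
    and D_pos: "t \<in> V \<Longrightarrow> measure M (D t) > 0"
    and D_split: "t \<in> V \<Longrightarrow> D t = D (L t) \<union> D (R t)"
    and D_disjoint: "t \<in> V \<Longrightarrow> D (L t) \<inter> D (R t) = {}"
    and L_large: "t \<in> V \<Longrightarrow> measure M (D t) \<le> 3 * measure M (D (L t))"
    and R_large: "t \<in> V \<Longrightarrow> measure M (D t) \<le> 3 * measure M (D (R t))"
begin

text \<open>For \<open>x\<close> in \<open>D t\<close> this is the label of the depth
  \<open>n\<close> piece containing \<open>x\<close>. Outside \<open>D t\<close> the value is a
  dummy.\<close>

primrec node :: "nat \<Rightarrow> 't \<Rightarrow> 'a \<Rightarrow> 't" where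
  "node 0 t x = t"
| "node (Suc n) t x = (if x \<in> D (L t) then node n (L t) x else node n (R t) x)"

lemma node_in: "t \<in> V \<Longrightarrow> node n t x \<in> V"
  by (induction n arbitrary: t) (auto intro: L_in R_in)

lemma node_add: "node (n + m) t x = node m (node n t x) x"
  by (induction n arbitrary: t) auto

lemma in_D_node: "t \<in> V \<Longrightarrow> x \<in> D t \<Longrightarrow> x \<in> D (node n t x)"
proof (induction n arbitrary: t)
  case (Suc n)
  then show ?case using D_split[OF Suc.prems(1)] L_in[OF Suc.prems(1)] R_in[OF Suc.prems(1)] by auto
qed simp

lemma D_node_Suc_subset: "t \<in> V \<Longrightarrow> D (node (Suc n) t x) \<subseteq> D (node n t x)"
proof (induction n arbitrary: t)
  case 0 then show ?case using D_split[OF 0] by auto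
next
  case (Suc n)
  then show ?case using L_in[OF Suc.prems] R_in[OF Suc.prems] by simp
qed

lemma nn_integral_split:
  assumes t: "t \<in> V" and [measurable]: "f \<in> borel_measurable M"
  shows "(\<integral>\<^sup>+x\<in>D t. f x \<partial>M) = (\<integral>\<^sup>+x\<in>D (L t). f x \<partial>M) + (\<integral>\<^sup>+x\<in>D (R t). f x \<partial>M)"
proof -
  have [measurable]: "D (L t) \<in> sets M" "D (R t) \<in> sets M"
    using t by (auto intro: sets_D L_in R_in)
  have "f x * indicator (D t) x = f x * indicator (D (L t)) x + f x * indicator (D (R t)) x" for x
    using D_split[OF t] D_disjoint[OF t] by (auto split: split_indicator)
  then show ?thesis by (simp add: nn_integral_add)
qed

lemma measure_split:
  assumes t: "t \<in> V"
  shows "measure M (D t) = measure M (D (L t)) + measure M (D (R t))"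
proof -
  have "measure M (D (L t) \<union> D (R t)) = measure M (D (L t)) + measure M (D (R t))"
    using t by (intro measure_Union) (simp_all add: D_finite sets_D D_disjoint L_in R_in)
  then show ?thesis using D_split[OF t] by simp
qed

end

text \<open>The \<open>A1\<close> bound is required at every point, not almost everywhere; the
  weights of \<open>rubio_de_francia\<close> satisfy it in this form, so the inductions carry no
  exceptional sets.\<close>

locale A1_weight = binary_partition M V D L R
  for M :: "'a measure" and V :: "'t set" and D L R +
  fixes w :: "'a \<Rightarrow> ennreal" and K :: real
  assumes w_measurable [measurable]: "w \<in> borel_measurable M"
    and K_ge: "1 \<le> K"
    and w_finite: "t \<in> V \<Longrightarrow> (\<integral>\<^sup>+x\<in>D t. w x \<partial>M) \<noteq> top"
    and A1: "t \<in> V \<Longrightarrow> x \<in> D t \<Longrightarrow> (\<integral>\<^sup>+x\<in>D t. w x \<partial>M) / emeasure M (D t) \<le> ennreal K * w x"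
begin

definition mass :: "'t \<Rightarrow> real" where
  "mass t = enn2real (\<integral>\<^sup>+x\<in>D t. w x \<partial>M)"

definition av :: "'t \<Rightarrow> real" where
  "av t = mass t / measure M (D t)"

lemma mass_nonneg: "0 \<le> mass t"
  by (simp add: mass_def)

lemma av_nonneg: "0 \<le> av t"
  by (simp add: av_def mass_nonneg)

lemma ennreal_mass: "t \<in> V \<Longrightarrow> ennreal (mass t) = (\<integral>\<^sup>+x\<in>D t. w x \<partial>M)"
  using w_finite[of t] by (simp add: mass_def less_top)

lemma ennreal_av:
  assumes "t \<in> V"
  shows "ennreal (av t) = (\<integral>\<^sup>+x\<in>D t. w x \<partial>M) / emeasure M (D t)"
  using assms D_pos[OF assms] D_finite[OF assms]
  by (simp add: av_def divide_ennreal[symmetric] mass_nonneg ennreal_mass emeasure_eq_ennreal_measure)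

lemma av_mult_measure: "t \<in> V \<Longrightarrow> av t * measure M (D t) = mass t"
  using D_pos[of t] by (simp add: av_def)

lemma mass_split: "t \<in> V \<Longrightarrow> mass t = mass (L t) + mass (R t)"
proof -
  assume t: "t \<in> V"
  have "ennreal (mass t) = ennreal (mass (L t)) + ennreal (mass (R t))"
    using nn_integral_split[OF t w_measurable] t by (simp add: ennreal_mass L_in R_in)
  then show ?thesis by (simp add: mass_nonneg flip: ennreal_plus)
qed

text \<open>A child has no more mass and at least a third of the measure. This supplies the ratio 3
  in \<open>powr_increment_bound\<close>.\<close>

lemma av_child:
  assumes t: "t \<in> V" and c: "c = L t \<or> c = R t"
  shows "av c \<le> 3 * av t"
proof -
  have cV: "c \<in> V" using assms L_in R_in by auto
  have "mass c \<le> mass t" using c mass_split[OF t] mass_nonneg by auto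
  moreover have "measure M (D t) \<le> 3 * measure M (D c)" using c L_large[OF t] R_large[OF t] by auto
  ultimately have "mass c * measure M (D t) \<le> mass t * (3 * measure M (D c))"
    by (intro mult_mono mass_nonneg) auto
  then have "mass c * measure M (D t) / (measure M (D c) * measure M (D t))
      \<le> mass t * (3 * measure M (D c)) / (measure M (D c) * measure M (D t))"
    by (intro divide_right_mono) auto
  then show ?thesis
    using D_pos[OF t] D_pos[OF cV] unfolding av_def by (simp add: mult.commute)
qed

text \<open>The largest of \<open>a\<close> and the averages of \<open>w\<close> over the first \<open>n\<close> proper descendants of
  \<open>t\<close> containing \<open>x\<close>.\<close>

primrec mx :: "nat \<Rightarrow> 't \<Rightarrow> real \<Rightarrow> 'a \<Rightarrow> real" where
  "mx 0 t a x = a"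
| "mx (Suc n) t a x = (if x \<in> D (L t) then mx n (L t) (max a (av (L t))) x
                       else mx n (R t) (max a (av (R t))) x)"

lemma mx_ge: "a \<le> mx n t a x"
proof (induction n arbitrary: t a)
  case (Suc n)
  have "a \<le> mx n c (max a (av c)) x" for c using Suc.IH[of "max a (av c)" c] by simp
  then show ?case by simp
qed simp

lemma mx_Suc_ge: "mx n t a x \<le> mx (Suc n) t a x"
proof (induction n arbitrary: t a)
  case 0 then show ?case by simp
next
  case (Suc n)
  have "mx n c b x \<le> mx (Suc n) c b x" for c b by (rule Suc.IH)
  then show ?case unfolding mx.simps(2)[of "Suc n"] mx.simps(2)[of n t]
    by (cases "x \<in> D (L t)") (simp_all only: if_True if_False simp_thms)
qed

lemma mx_incseq: "incseq (\<lambda>n. mx n t a x)"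
  by (intro incseq_SucI mx_Suc_ge)

lemma mx_measurable [measurable]: "t \<in> V \<Longrightarrow> mx n t a \<in> borel_measurable M"
proof (induction n arbitrary: t a)
  case 0 then show ?case by (simp cong: measurable_cong)
next
  case (Suc n)
  have [measurable]: "D (L t) \<in> sets M" using Suc.prems sets_D L_in by auto
  have [measurable]: "mx n (L t) (max a (av (L t))) \<in> borel_measurable M"
    "mx n (R t) (max a (av (R t))) \<in> borel_measurable M"
    using Suc L_in R_in by auto
  have "mx (Suc n) t a = (\<lambda>x. if x \<in> D (L t) then mx n (L t) (max a (av (L t))) x
                       else mx n (R t) (max a (av (R t))) x)" by auto
  then show ?case by simp
qed

text \<open>Only finitely many averages enter at a fixed depth. Boundedness makes the integral that
  is absorbed in \<open>mx_reverse_Holder\<close> finite.\<close>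

lemma mx_bounded: "\<exists>B. \<forall>x. mx n t a x \<le> B"
proof (induction n arbitrary: t a)
  case (Suc n)
  obtain B1 where "\<forall>x. mx n (L t) (max a (av (L t))) x \<le> B1" using Suc by blast
  moreover obtain B2 where "\<forall>x. mx n (R t) (max a (av (R t))) x \<le> B2" using Suc by blast
  ultimately show ?case by (intro exI[of _ "max B1 B2"]) (auto simp: le_max_iff_disj)
qed auto

lemma mx_le_weight:
  "t \<in> V \<Longrightarrow> x \<in> D t \<Longrightarrow> ennreal a \<le> ennreal K * w x \<Longrightarrow> ennreal (mx n t a x) \<le> ennreal K * w x"
proof (induction n arbitrary: t a)
  case (Suc n)
  have *: "ennreal (max a (av c)) \<le> ennreal K * w x" if "c \<in> V" "x \<in> D c" for c
    using A1[OF that] ennreal_av[OF that(1)] Suc.prems(3) by (simp add: max_def)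
  show ?case
    using Suc.prems D_split[OF Suc.prems(1)] L_in[OF Suc.prems(1)] R_in[OF Suc.prems(1)]
    by (auto intro!: Suc.IH *)
qed simp

text \<open>The term with \<open>3 * \<delta>\<close> on the left is what \<open>powr_increment_bound\<close> lets telescope when \<open>a\<close>
  is raised to the average of a child; it is absorbed later because \<open>w\<close> dominates \<open>mx / K\<close>.\<close>

lemma mx_energy:
  assumes \<delta>: "0 < \<delta>" "\<delta> \<le> 1"
  shows "t \<in> V \<Longrightarrow> av t \<le> a \<Longrightarrow>
    (\<integral>\<^sup>+x\<in>D t. (ennreal (mx n t a x powr \<delta>) * w x) \<partial>M) + ennreal (3 * \<delta> * a powr (1 + \<delta>) * measure M (D t))
    \<le> ennreal (a powr \<delta> * mass t) + ennreal (3 * \<delta>) * (\<integral>\<^sup>+x\<in>D t. ennreal (mx n t a x powr (1 + \<delta>)) \<partial>M)"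
proof (induction n arbitrary: t a)
  case 0
  have [measurable]: "D t \<in> sets M" using 0 sets_D by auto
  have "(\<integral>\<^sup>+x\<in>D t. (ennreal (a powr \<delta>) * w x) \<partial>M) = ennreal (a powr \<delta>) * (\<integral>\<^sup>+x\<in>D t. w x \<partial>M)"
    by (simp add: mult.assoc nn_integral_cmult)
  also have "\<dots> = ennreal (a powr \<delta> * mass t)"
    using 0 by (simp add: ennreal_mass[symmetric] ennreal_mult mass_nonneg)
  finally have 1: "(\<integral>\<^sup>+x\<in>D t. (ennreal (a powr \<delta>) * w x) \<partial>M) = ennreal (a powr \<delta> * mass t)" .
  have 2: "ennreal (3 * \<delta> * a powr (1 + \<delta>) * measure M (D t)) =
    ennreal (3 * \<delta>) * (\<integral>\<^sup>+x\<in>D t. ennreal (a powr (1 + \<delta>)) \<partial>M)"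
    using \<delta> D_finite[OF 0(1)]
    by (simp add: nn_integral_cmult emeasure_eq_ennreal_measure mult.assoc flip: ennreal_mult)
  show ?case using 1 2 by simp
next
  case (Suc n)
  note t = Suc.prems(1)
  have a0: "0 \<le> a" using Suc.prems(2) av_nonneg[of t] by simp
  define I where "I c = (\<integral>\<^sup>+x\<in>D c. (ennreal (mx n c (max a (av c)) x powr \<delta>) * w x) \<partial>M)" for c
  define J where "J c = (\<integral>\<^sup>+x\<in>D c. ennreal (mx n c (max a (av c)) x powr (1 + \<delta>)) \<partial>M)" for c
  have child: "I c + ennreal (3 * \<delta> * a powr (1 + \<delta>) * measure M (D c))
     \<le> ennreal (a powr \<delta> * mass c) + ennreal (3 * \<delta>) * J c" if c: "c = L t \<or> c = R t" for c
  proof -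
    have cV: "c \<in> V" using c t L_in R_in by auto
    define b where "b = max a (av c)"
    define X where "X = 3 * \<delta> * b powr (1 + \<delta>) * measure M (D c)"
    have IH: "I c + ennreal X \<le> ennreal (b powr \<delta> * mass c) + ennreal (3 * \<delta>) * J c"
      unfolding I_def J_def X_def b_def by (rule Suc.IH[OF cV]) simp
    \<comment> \<open>Either \<open>b = a\<close> and both sides vanish, or \<open>b = av c\<close>
      lies between \<open>a\<close> and \<open>3 * av t \<le> 3 * a\<close>.\<close>
    have "(b powr \<delta> - a powr \<delta>) * av c \<le> 3 * \<delta> * (b powr (1 + \<delta>) - a powr (1 + \<delta>))"
    proof (cases "av c \<le> a")
      case True then show ?thesis by (simp add: b_def max_absorb1)
    next
      case False
      then have "b = av c" by (simp add: b_def)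
      then show ?thesis
        using powr_increment_bound[OF \<delta> a0, of b] False av_child[OF t c] Suc.prems(2) by simp
    qed
    then have "(b powr \<delta> - a powr \<delta>) * av c * measure M (D c)
      \<le> 3 * \<delta> * (b powr (1 + \<delta>) - a powr (1 + \<delta>)) * measure M (D c)"
      by (rule mult_right_mono) simp
    then have "b powr \<delta> * mass c + 3 * \<delta> * a powr (1 + \<delta>) * measure M (D c) \<le> a powr \<delta> * mass c + X"
      unfolding mult.assoc av_mult_measure[OF cV] by (simp add: X_def algebra_simps)
    from ennreal_leI[OF this] have real: "ennreal (b powr \<delta> * mass c) + ennreal (3 * \<delta> * a powr (1 + \<delta>) * measure M (D c))
      \<le> ennreal (a powr \<delta> * mass c) + ennreal X"
      using \<delta> by (simp add: X_def mass_nonneg)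
    \<comment> \<open>Subtraction is unsafe in the extended reals, so the finite \<open>X\<close> is
      added to both sides and cancelled at the end.\<close>
    have "ennreal X + (I c + ennreal (3 * \<delta> * a powr (1 + \<delta>) * measure M (D c)))
       = (I c + ennreal X) + ennreal (3 * \<delta> * a powr (1 + \<delta>) * measure M (D c))"
      by (simp add: ac_simps)
    also have "\<dots> \<le> (ennreal (b powr \<delta> * mass c) + ennreal (3 * \<delta>) * J c)
        + ennreal (3 * \<delta> * a powr (1 + \<delta>) * measure M (D c))"
      by (intro add_mono IH order_refl)
    also have "\<dots> = ennreal (3 * \<delta>) * J c + (ennreal (b powr \<delta> * mass c)
        + ennreal (3 * \<delta> * a powr (1 + \<delta>) * measure M (D c)))"
      by (simp add: ac_simps)
    also have "\<dots> \<le> ennreal (3 * \<delta>) * J c + (ennreal (a powr \<delta> * mass c) + ennreal X)"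
      by (intro add_mono real order_refl)
    also have "\<dots> = ennreal X + (ennreal (a powr \<delta> * mass c) + ennreal (3 * \<delta>) * J c)"
      by (simp add: ac_simps)
    finally show ?thesis by (simp add: ennreal_add_left_cancel_le)
  qed
  \<comment> \<open>On the right child the test \<open>x \<in> D (L t)\<close> fails by
    disjointness, so \<open>mx\<close> unfolds to the branch of \<open>c\<close> in both
    cases.\<close>
  have cong: "(\<integral>\<^sup>+x\<in>D c. f (mx (Suc n) t a x) x \<partial>M)
      = (\<integral>\<^sup>+x\<in>D c. f (mx n c (max a (av c)) x) x \<partial>M)"
    if "c = L t \<or> c = R t" for c and f :: "real \<Rightarrow> 'a \<Rightarrow> ennreal"
    using that D_disjoint[OF t] by (intro nn_integral_cong) (auto split: split_indicator)
  have [measurable]: "mx (Suc n) t a \<in> borel_measurable M" by (rule mx_measurable[OF t])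
  have 1: "(\<integral>\<^sup>+x\<in>D t. (ennreal (mx (Suc n) t a x powr \<delta>) * w x) \<partial>M) = I (L t) + I (R t)"
    unfolding I_def
    using nn_integral_split[OF t, of "\<lambda>x. ennreal (mx (Suc n) t a x powr \<delta>) * w x"]
      cong[of "L t" "\<lambda>m x. ennreal (m powr \<delta>) * w x"] cong[of "R t" "\<lambda>m x. ennreal (m powr \<delta>) * w x"]
    by (simp del: mx.simps)
  have 2: "(\<integral>\<^sup>+x\<in>D t. ennreal (mx (Suc n) t a x powr (1 + \<delta>)) \<partial>M) = J (L t) + J (R t)"
    unfolding J_def
    using nn_integral_split[OF t, of "\<lambda>x. ennreal (mx (Suc n) t a x powr (1 + \<delta>))"]
      cong[of "L t" "\<lambda>m x. ennreal (m powr (1 + \<delta>))"] cong[of "R t" "\<lambda>m x. ennreal (m powr (1 + \<delta>))"]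
    by (simp del: mx.simps)
  have 3: "ennreal (3 * \<delta> * a powr (1 + \<delta>) * measure M (D t)) =
      ennreal (3 * \<delta> * a powr (1 + \<delta>) * measure M (D (L t))) + ennreal (3 * \<delta> * a powr (1 + \<delta>) * measure M (D (R t)))"
    using \<delta> by (simp add: measure_split[OF t] distrib_left)
  have 4: "ennreal (a powr \<delta> * mass t) = ennreal (a powr \<delta> * mass (L t)) + ennreal (a powr \<delta> * mass (R t))"
    by (simp add: mass_split[OF t] distrib_left mass_nonneg)
  show ?case
    unfolding 1 2 3 4
    using add_mono[OF child[of "L t"] child[of "R t"]] by (simp add: distrib_left ac_simps)
qed

text \<open>One factor of the power of \<open>mx\<close> is replaced by \<open>K * w\<close>, which
  turns the integral into the one bounded by \<open>mx_energy\<close>. That bound returns the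
  original integral \<open>Y\<close> with coefficient \<open>3 * K * \<delta>\<close>, at most one
  half, and \<open>Y\<close> is finite.\<close>

lemma mx_reverse_Holder:
  assumes \<delta>: "0 < \<delta>" "6 * K * \<delta> \<le> 1" and t: "t \<in> V"
  shows "(\<integral>\<^sup>+x\<in>D t. ennreal (mx n t (av t) x powr (1 + \<delta>)) \<partial>M)
    \<le> ennreal (2 * K * av t powr (1 + \<delta>)) * emeasure M (D t)"
proof -
  define Y where "Y = (\<integral>\<^sup>+x\<in>D t. ennreal (mx n t (av t) x powr (1 + \<delta>)) \<partial>M)"
  have \<delta>1: "\<delta> \<le> 1"
  proof -
    have "1 * \<delta> \<le> (6 * K) * \<delta>" using K_ge \<delta>(1) by (intro mult_right_mono) auto
    with \<delta>(2) show ?thesis by linarith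
  qed
  have [measurable]: "D t \<in> sets M" "mx n t (av t) \<in> borel_measurable M"
    using t sets_D mx_measurable by auto
  have m0: "0 \<le> mx n t (av t) x" for x using mx_ge[of "av t" n t x] av_nonneg[of t] by simp
  obtain B where B: "\<And>x. mx n t (av t) x \<le> B" using mx_bounded by blast
  have "Y \<le> (\<integral>\<^sup>+x\<in>D t. ennreal (B powr (1 + \<delta>)) \<partial>M)"
    unfolding Y_def using \<delta> B m0
    by (intro nn_integral_mono mult_right_mono ennreal_leI powr_mono2) auto
  also have "\<dots> < top"
    using D_finite[OF t] by (simp add: nn_integral_cmult ennreal_mult_less_top less_top)
  finally have Yfin: "Y < top" .
  have "Y \<le> (\<integral>\<^sup>+x. ennreal K * (ennreal (mx n t (av t) x powr \<delta>) * w x * indicator (D t) x) \<partial>M)"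
    unfolding Y_def
  proof (intro nn_integral_mono)
    fix x
    have "ennreal (mx n t (av t) x powr (1 + \<delta>)) \<le> ennreal K * (ennreal (mx n t (av t) x powr \<delta>) * w x)"
      if x: "x \<in> D t"
    proof -
      have "ennreal (av t) \<le> ennreal K * w x" using A1[OF t x] ennreal_av[OF t] by simp
      from mx_le_weight[OF t x this]
      have "ennreal (mx n t (av t) x powr \<delta>) * ennreal (mx n t (av t) x)
         \<le> ennreal (mx n t (av t) x powr \<delta>) * (ennreal K * w x)" by (rule mult_left_mono) simp
      then show ?thesis using m0[of x] \<delta> by (simp add: powr_add ennreal_mult ac_simps powr_one_gt_zero_iff flip: ennreal_mult)
    qed
    then show "ennreal (mx n t (av t) x powr (1 + \<delta>)) * indicator (D t) x
      \<le> ennreal K * (ennreal (mx n t (av t) x powr \<delta>) * w x * indicator (D t) x)"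
      by (auto split: split_indicator)
  qed
  also have "\<dots> = ennreal K * (\<integral>\<^sup>+x\<in>D t. (ennreal (mx n t (av t) x powr \<delta>) * w x) \<partial>M)"
    by (rule nn_integral_cmult) measurable
  also have "\<dots> \<le> ennreal K * (ennreal (av t powr \<delta> * mass t) + ennreal (3 * \<delta>) * Y)"
    unfolding Y_def
    by (intro mult_left_mono order_trans[OF _ mx_energy[OF \<delta>(1) \<delta>1 t order_refl]]) auto
  finally have *: "Y \<le> ennreal K * (ennreal (av t powr \<delta> * mass t) + ennreal (3 * \<delta>) * Y)" .
  obtain y where y: "0 \<le> y" "Y = ennreal y" using Yfin by (cases Y) auto
  have "y \<le> K * (av t powr \<delta> * mass t + 3 * \<delta> * y)"
    using * y \<delta> K_ge mass_nonneg[of t]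
    by (simp flip: ennreal_mult ennreal_plus)
  moreover have "(6 * K * \<delta>) * y \<le> 1 * y" using \<delta> y by (intro mult_right_mono) auto
  ultimately have "y \<le> 2 * K * (av t powr \<delta> * mass t)" by (simp add: algebra_simps)
  also have "\<dots> = 2 * K * av t powr (1 + \<delta>) * measure M (D t)"
    using D_pos[OF t] av_nonneg[of t] by (simp add: powr_add) (simp add: av_def)
  finally have "Y \<le> ennreal (2 * K * av t powr (1 + \<delta>) * measure M (D t))"
    unfolding y by (rule ennreal_leI)
  also have "\<dots> = ennreal (2 * K * av t powr (1 + \<delta>)) * emeasure M (D t)"
    using K_ge D_finite[OF t] by (simp add: ennreal_mult emeasure_eq_ennreal_measure)
  finally show ?thesis unfolding Y_def .
qed

section \<open>Domination of the weight by its maximal function\<close>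

lemma mx_sublevel_sets:
  "t \<in> V \<Longrightarrow> {x \<in> D t. mx n t a x \<le> \<tau> \<and> D (node n t x) \<subseteq> U} \<in> sets M"
proof (induction n arbitrary: t a)
  case 0 then show ?case using sets_D[of t] by (cases "a \<le> \<tau> \<and> D t \<subseteq> U") auto
next
  case (Suc n)
  define S where "S c = {x \<in> D c. mx n c (max a (av c)) x \<le> \<tau> \<and> D (node n c x) \<subseteq> U}" for c
  have "S (L t) \<in> sets M" "S (R t) \<in> sets M" unfolding S_def using Suc L_in R_in by auto
  moreover have "{x \<in> D t. mx (Suc n) t a x \<le> \<tau> \<and> D (node (Suc n) t x) \<subseteq> U} = S (L t) \<union> S (R t)"
    using D_split[OF Suc.prems] D_disjoint[OF Suc.prems] by (auto simp: S_def)
  ultimately show ?case by auto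
qed

text \<open>Descendants inside \<open>U\<close> on which the maximal function stays below \<open>\<tau>\<close> have average at most
  \<open>\<tau>\<close>.  Together with outer regularity this replaces the Lebesgue differentiation theorem.\<close>

lemma mx_sublevel_mass:
  assumes "U \<in> sets M" "0 \<le> \<tau>"
  shows "t \<in> V \<Longrightarrow> av t \<le> a \<Longrightarrow>
    (\<integral>\<^sup>+x\<in>{x \<in> D t. mx n t a x \<le> \<tau> \<and> D (node n t x) \<subseteq> U}. w x \<partial>M) \<le> ennreal \<tau> * emeasure M (U \<inter> D t)"
proof (induction n arbitrary: t a)
  case 0
  show ?case
  proof (cases "a \<le> \<tau> \<and> D t \<subseteq> U")
    case True
    have "(\<integral>\<^sup>+x\<in>D t. w x \<partial>M) = ennreal (av t * measure M (D t))"
      using 0 D_pos[OF 0(1)] by (simp add: av_def ennreal_mass)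
    also have "\<dots> \<le> ennreal (\<tau> * measure M (D t))"
      using True 0 by (intro ennreal_leI mult_right_mono) auto
    also have "\<dots> = ennreal \<tau> * emeasure M (D t)"
      using assms D_finite[OF 0(1)] by (simp add: ennreal_mult emeasure_eq_ennreal_measure)
    finally show ?thesis using True by (simp add: Int_absorb1)
  qed auto
next
  case (Suc n)
  note t = Suc.prems(1)
  have [measurable]: "D (L t) \<in> sets M" "D (R t) \<in> sets M"
    using t by (auto intro: sets_D L_in R_in)
  define S where "S c = {x \<in> D c. mx n c (max a (av c)) x \<le> \<tau> \<and> D (node n c x) \<subseteq> U}" for c
  have [measurable]: "S (L t) \<in> sets M" "S (R t) \<in> sets M"
    unfolding S_def using t by (auto intro!: mx_sublevel_sets L_in R_in)
  have S: "{x \<in> D t. mx (Suc n) t a x \<le> \<tau> \<and> D (node (Suc n) t x) \<subseteq> U} = S (L t) \<union> S (R t)"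
    using D_split[OF t] D_disjoint[OF t] by (auto simp: S_def)
  have "(\<integral>\<^sup>+x\<in>S (L t) \<union> S (R t). w x \<partial>M)
      \<le> (\<integral>\<^sup>+x. w x * indicator (S (L t)) x + w x * indicator (S (R t)) x \<partial>M)"
    by (intro nn_integral_mono) (auto split: split_indicator)
  also have "\<dots> = (\<integral>\<^sup>+x\<in>S (L t). w x \<partial>M) + (\<integral>\<^sup>+x\<in>S (R t). w x \<partial>M)"
    by (rule nn_integral_add) measurable
  also have "\<dots> \<le> ennreal \<tau> * emeasure M (U \<inter> D (L t)) + ennreal \<tau> * emeasure M (U \<inter> D (R t))"
    unfolding S_def by (intro add_mono Suc.IH) (auto intro: L_in R_in t)
  also have "\<dots> = ennreal \<tau> * emeasure M (U \<inter> D t)"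
  proof -
    have "emeasure M (U \<inter> D (L t)) + emeasure M (U \<inter> D (R t)) = emeasure M ((U \<inter> D (L t)) \<union> (U \<inter> D (R t)))"
      using assms D_disjoint[OF t] by (intro plus_emeasure) auto
    also have "(U \<inter> D (L t)) \<union> (U \<inter> D (R t)) = U \<inter> D t" using D_split[OF t] by auto
    finally show ?thesis by (simp flip: distrib_left)
  qed
  finally show ?case unfolding S .
qed

text \<open>For each \<open>\<tau>\<close> let \<open>E\<close> be the set where the maximal
  function is at most \<open>\<tau>\<close> but \<open>w\<close> exceeds it. Covering
  \<open>E\<close> by \<open>U\<close> and applying \<open>mx_sublevel_mass\<close> bounds the
  integral of \<open>w\<close> over \<open>E\<close> by \<open>\<tau>\<close> times the measure of
  \<open>E\<close>, which forces \<open>E\<close> to be null.\<close>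

lemma AE_le_SUP_mx:
  assumes t: "t \<in> V"
    and outer: "\<And>E e. E \<in> sets M \<Longrightarrow> E \<subseteq> D t \<Longrightarrow> 0 < e \<Longrightarrow> \<exists>U\<in>sets M. E \<subseteq> U \<and>
       emeasure M U \<le> emeasure M E + ennreal e \<and> (\<forall>x\<in>U \<inter> D t. \<exists>n. D (node n t x) \<subseteq> U)"
  shows "AE x in M. x \<in> D t \<longrightarrow> w x \<le> (SUP n. ennreal (mx n t (av t) x))"
proof -
  have [measurable]: "D t \<in> sets M" "\<And>n. mx n t (av t) \<in> borel_measurable M"
    using t sets_D mx_measurable by auto
  define m where "m x = (SUP n. ennreal (mx n t (av t) x))" for x
  have [measurable]: "m \<in> borel_measurable M" unfolding m_def by measurable
  have wfin: "AE x in M. x \<in> D t \<longrightarrow> w x \<noteq> top"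
  proof -
    have "AE x in M. w x * indicator (D t) x \<noteq> \<infinity>"
      using w_finite[OF t] by (intro nn_integral_PInf_AE) auto
    then show ?thesis by eventually_elim auto
  qed
  have null: "AE x in M. \<not> (x \<in> D t \<and> m x \<le> ennreal \<tau> \<and> ennreal \<tau> < w x)" if "\<tau> \<ge> 0" for \<tau> :: real
  proof -
    define E where "E = {x \<in> space M. x \<in> D t \<and> m x \<le> ennreal \<tau> \<and> ennreal \<tau> < w x}"
    have Em [measurable]: "E \<in> sets M" unfolding E_def by measurable
    have ED: "E \<subseteq> D t" by (auto simp: E_def)
    have Efin: "emeasure M E < top"
      using D_finite[OF t] by (intro order_le_less_trans[OF emeasure_mono[OF ED]]) (simp_all add: less_top)
    have approx: "(\<integral>\<^sup>+x\<in>E. w x \<partial>M) \<le> ennreal \<tau> * emeasure M E + ennreal e" if "0 < e" for e :: real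
    proof -
      \<comment> \<open>The denominator \<open>\<tau> + 1\<close> is positive even for
        \<open>\<tau> = 0\<close>, and \<open>\<tau> * (e / (\<tau> + 1)) \<le> e\<close>.\<close>
      obtain U where [measurable]: "U \<in> sets M" and U: "E \<subseteq> U"
          "emeasure M U \<le> emeasure M E + ennreal (e / (\<tau> + 1))"
          "\<forall>x\<in>U \<inter> D t. \<exists>n. D (node n t x) \<subseteq> U"
        using outer[of E "e / (\<tau> + 1)"] ED \<open>0 < e\<close> \<open>\<tau> \<ge> 0\<close> by auto
      define S where "S n = {x \<in> D t. mx n t (av t) x \<le> \<tau> \<and> D (node n t x) \<subseteq> U}" for n
      have [measurable]: "S n \<in> sets M" for n unfolding S_def by (rule mx_sublevel_sets[OF t])
      \<comment> \<open>The pieces shrink with depth, so \<open>T n\<close> increases, and by the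
        choice of \<open>U\<close> it exhausts \<open>E\<close>. On \<open>E\<close> the maximal
        function is at most \<open>\<tau>\<close>, so \<open>T n\<close> lies in
        \<open>S n\<close>.\<close>
      define T where "T n = {x \<in> D t. D (node n t x) \<subseteq> U} \<inter> E" for n
      have TE: "T n = S n \<inter> E" for n
      proof -
        have "mx n t (av t) x \<le> \<tau>" if "x \<in> E" for x
        proof -
          have "ennreal (mx n t (av t) x) \<le> m x" unfolding m_def by (rule SUP_upper) simp
          also have "m x \<le> ennreal \<tau>" using that by (simp add: E_def)
          finally show ?thesis using \<open>\<tau> \<ge> 0\<close> by (simp add: ennreal_le_iff)
        qed
        then show ?thesis by (auto simp: T_def S_def)
      qed
      have [measurable]: "T n \<in> sets M" for n unfolding TE by measurable
      have incT: "incseq T"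
        using order_trans[OF D_node_Suc_subset[OF t]]
        by (intro incseq_SucI) (auto simp: T_def simp del: node.simps)
      have UT: "(\<Union>n. T n) = E"
      proof (intro equalityI subsetI)
        fix x assume "x \<in> E"
        then have "x \<in> U \<inter> D t" using U(1) ED by blast
        with U(3) obtain n where "D (node n t x) \<subseteq> U" by blast
        then show "x \<in> (\<Union>n. T n)" using \<open>x \<in> E\<close> ED unfolding T_def by blast
      qed (auto simp: T_def)
      have "(\<integral>\<^sup>+x\<in>E. w x \<partial>M) = emeasure (density M w) (\<Union>n. T n)"
        by (simp add: UT emeasure_density)
      also have "\<dots> = (SUP n. emeasure (density M w) (T n))"
        by (rule SUP_emeasure_incseq[symmetric]) (use incT in auto)
      also have "\<dots> \<le> ennreal \<tau> * emeasure M U"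
      proof (rule SUP_least)
        fix n
        have "emeasure (density M w) (T n) = (\<integral>\<^sup>+x\<in>T n. w x \<partial>M)" by (simp add: emeasure_density)
        also have "\<dots> \<le> (\<integral>\<^sup>+x\<in>S n. w x \<partial>M)"
          by (intro nn_integral_mono) (auto simp: TE split: split_indicator)
        also have "\<dots> \<le> ennreal \<tau> * emeasure M (U \<inter> D t)"
          unfolding S_def using \<open>\<tau> \<ge> 0\<close> by (intro mx_sublevel_mass t) auto
        also have "\<dots> \<le> ennreal \<tau> * emeasure M U" by (intro mult_left_mono emeasure_mono) auto
        finally show "emeasure (density M w) (T n) \<le> ennreal \<tau> * emeasure M U" .
      qed
      also have "\<dots> \<le> ennreal \<tau> * (emeasure M E + ennreal (e / (\<tau> + 1)))"
        by (intro mult_left_mono U) auto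
      also have "\<dots> = ennreal \<tau> * emeasure M E + ennreal (\<tau> * (e / (\<tau> + 1)))"
        using \<open>\<tau> \<ge> 0\<close> \<open>0 < e\<close> by (simp add: distrib_left flip: ennreal_mult)
      also have "\<dots> \<le> ennreal \<tau> * emeasure M E + ennreal e"
        using \<open>\<tau> \<ge> 0\<close> \<open>0 < e\<close> by (intro add_left_mono ennreal_leI) (simp add: field_simps)
      finally show ?thesis .
    qed
    have le: "(\<integral>\<^sup>+x\<in>E. w x \<partial>M) \<le> ennreal \<tau> * emeasure M E"
      by (rule ennreal_le_epsilon) (rule approx)
    \<comment> \<open>Truncated subtraction is exact here since \<open>w\<close> exceeds
      \<open>\<tau>\<close> on \<open>E\<close>.\<close>
    have split: "(\<integral>\<^sup>+x\<in>E. w x \<partial>M) = ennreal \<tau> * emeasure M E + (\<integral>\<^sup>+x\<in>E. (w x - ennreal \<tau>) \<partial>M)"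
    proof -
      have "(\<integral>\<^sup>+x\<in>E. w x \<partial>M) = (\<integral>\<^sup>+x. ennreal \<tau> * indicator E x + (w x - ennreal \<tau>) * indicator E x \<partial>M)"
        by (intro nn_integral_cong) (auto simp: E_def add_diff_inverse_ennreal less_imp_le split: split_indicator)
      also have "\<dots> = (\<integral>\<^sup>+x. ennreal \<tau> * indicator E x \<partial>M) + (\<integral>\<^sup>+x\<in>E. (w x - ennreal \<tau>) \<partial>M)"
        by (rule nn_integral_add) measurable
      finally show ?thesis by (simp add: nn_integral_cmult_indicator[OF Em])
    qed
    have "ennreal \<tau> * emeasure M E < top" using Efin by (simp add: ennreal_mult_less_top)
    then have "(\<integral>\<^sup>+x\<in>E. (w x - ennreal \<tau>) \<partial>M) = 0"
      using le ennreal_add_left_cancel_le[of "ennreal \<tau> * emeasure M E" _ 0] unfolding split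
      by auto
    then have "AE x in M. (w x - ennreal \<tau>) * indicator E x = 0"
      by (subst (asm) nn_integral_0_iff_AE) auto
    then show ?thesis
      using AE_space by eventually_elim (auto simp: E_def diff_eq_0_iff_ennreal split: split_indicator_asm)
  qed
  \<comment> \<open>Rational thresholds keep the union of exceptional sets countable, and one of
    them separates any two distinct values.\<close>
  have "AE x in M. \<forall>q::rat. 0 \<le> real_of_rat q \<longrightarrow>
      \<not> (x \<in> D t \<and> m x \<le> ennreal (real_of_rat q) \<and> ennreal (real_of_rat q) < w x)"
    using null by (subst AE_all_countable) auto
  then show ?thesis
    using wfin
  proof eventually_elim
    case (elim x)
    show ?case
    proof (intro impI leI notI)
      assume x: "x \<in> D t" and "(SUP n. ennreal (mx n t (av t) x)) < w x"
      then have lt: "m x < w x" by (simp add: m_def)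
      obtain a where a: "0 \<le> a" "m x = ennreal a" using lt by (cases "m x") auto
      obtain b where b: "0 \<le> b" "w x = ennreal b" using elim(2) x by (cases "w x") auto
      have "a < b" using lt a b by (simp add: ennreal_less_iff)
      then obtain q where q: "a < real_of_rat q" "real_of_rat q < b" using of_rat_dense by blast
      then have q0: "0 \<le> real_of_rat q" using a(1) by linarith
      with q show False using elim(1)[rule_format, OF q0] x a b by (auto simp: ennreal_less_iff ennreal_le_iff)
    qed
  qed
qed

text \<open>The bound of \<open>mx_reverse_Holder\<close> does not depend on the depth, so monotone
  convergence passes it to the supremum, which dominates \<open>w\<close> almost everywhere.\<close>

theorem reverse_Holder:
  assumes \<delta>: "0 < \<delta>" "6 * K * \<delta> \<le> 1" and t: "t \<in> V"
    and outer: "\<And>E e. E \<in> sets M \<Longrightarrow> E \<subseteq> D t \<Longrightarrow> 0 < e \<Longrightarrow> \<exists>U\<in>sets M. E \<subseteq> U \<and>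
       emeasure M U \<le> emeasure M E + ennreal e \<and> (\<forall>x\<in>U \<inter> D t. \<exists>n. D (node n t x) \<subseteq> U)"
  shows "(\<integral>\<^sup>+x\<in>D t. ennreal_powr (w x) (1 + \<delta>) \<partial>M)
    \<le> ennreal (2 * K) * ennreal_powr ((\<integral>\<^sup>+x\<in>D t. w x \<partial>M) / emeasure M (D t)) (1 + \<delta>) * emeasure M (D t)"
proof -
  have [measurable]: "D t \<in> sets M" "\<And>n. mx n t (av t) \<in> borel_measurable M"
    using t sets_D mx_measurable by auto
  have m0: "0 \<le> mx n t (av t) x" for n x using mx_ge[of "av t" n t x] av_nonneg[of t] by simp
  have "(\<integral>\<^sup>+x\<in>D t. ennreal_powr (w x) (1 + \<delta>) \<partial>M)
      \<le> (\<integral>\<^sup>+x. (SUP n. ennreal (mx n t (av t) x powr (1 + \<delta>)) * indicator (D t) x) \<partial>M)"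
  proof (rule nn_integral_mono_AE)
    have "AE x in M. x \<in> D t \<longrightarrow> w x \<le> (SUP n. ennreal (mx n t (av t) x))"
      by (rule AE_le_SUP_mx[OF t]) (rule outer)
    then show "AE x in M. ennreal_powr (w x) (1 + \<delta>) * indicator (D t) x
        \<le> (SUP n. ennreal (mx n t (av t) x powr (1 + \<delta>)) * indicator (D t) x)"
    proof eventually_elim
      case (elim x)
      show ?case
      proof (cases "x \<in> D t")
        case True
        then have "ennreal_powr (w x) (1 + \<delta>) \<le> ennreal_powr (SUP n. ennreal (mx n t (av t) x)) (1 + \<delta>)"
          using elim \<delta> by (intro ennreal_powr_mono) auto
        also have "\<dots> \<le> (SUP n. ennreal_powr (ennreal (mx n t (av t) x)) (1 + \<delta>))"
          using \<delta> by (intro ennreal_powr_SUP) auto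
        finally show ?thesis using True m0 by (simp add: ennreal_powr_ennreal)
      qed simp
    qed
  qed
  also have "\<dots> = (SUP n. (\<integral>\<^sup>+x\<in>D t. ennreal (mx n t (av t) x powr (1 + \<delta>)) \<partial>M))"
  proof (rule nn_integral_monotone_convergence_SUP)
    show "incseq (\<lambda>n x. ennreal (mx n t (av t) x powr (1 + \<delta>)) * indicator (D t) x)"
      using m0 \<delta> mx_incseq[of t "av t"]
      by (auto simp: incseq_def le_fun_def intro!: mult_right_mono ennreal_leI powr_mono2)
  qed measurable
  also have "\<dots> \<le> ennreal (2 * K * av t powr (1 + \<delta>)) * emeasure M (D t)"
    by (intro SUP_least mx_reverse_Holder \<delta> t)
  also have "\<dots> = ennreal (2 * K) * ennreal_powr (ennreal (av t)) (1 + \<delta>) * emeasure M (D t)"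
    using K_ge by (simp add: ennreal_powr_ennreal av_nonneg ennreal_mult)
  finally show ?thesis by (simp add: ennreal_av[OF t])
qed

end

section \<open>Generalized intervals\<close>

text \<open>Basic open sets of the product restrict finitely many coordinates. Real sequences appear
  because outer regularity is applied there.\<close>

lemma open_contains_cylinder:
  fixes U :: "(nat \<Rightarrow> real) set"
  assumes "open U" "x \<in> U"
  shows "\<exists>k. \<forall>y. (\<forall>i<k. y i = x i) \<longrightarrow> y \<in> U"
proof -
  have "openin (product_topology (\<lambda>_. euclidean) UNIV) U"
    using assms(1) by (simp add: open_fun_def)
  from product_topology_open_contains_basis[OF this assms(2)]
  obtain X where X: "x \<in> (\<Pi>\<^sub>E i\<in>UNIV. X i)" "finite {i. X i \<noteq> UNIV}" "(\<Pi>\<^sub>E i\<in>UNIV. X i) \<subseteq> U"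
    by auto
  obtain k where k: "{i. X i \<noteq> UNIV} \<subseteq> {..<k}" using finite_nat_iff_bounded X(2) by blast
  have "y \<in> U" if y: "\<forall>i<k. y i = x i" for y
  proof -
    have "y i \<in> X i" for i
    proof (cases "i < k")
      case True then show ?thesis using X(1) y by (auto simp: PiE_def Pi_def)
    next
      case False then have "X i = UNIV" using k by auto
      then show ?thesis by simp
    qed
    then show ?thesis using X(3) by auto
  qed
  then show ?thesis by blast
qed

section \<open>The Haar space and its generalized intervals as arcs\<close>

locale vilenkin_haar =
  fixes P :: "nat \<Rightarrow> nat" and \<mu> :: "(nat \<Rightarrow> int) measure"
  assumes P2: "\<And>i. 2 \<le> P i" and haar: "normalized_haar P \<mu>"
begin

abbreviation G :: "(nat \<Rightarrow> int) set" where "G \<equiv> carrier (vgroup P)"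

lemma P_pos: "0 < P i"
  using P2[of i] by simp

lemma in_G_iff: "x \<in> G \<longleftrightarrow> (\<forall>i. 0 \<le> x i \<and> x i < int (P i))"
  using carrier_vgroup[of P] P2 by simp

lemma haar_cases:
  obtains \<nu> where "\<mu> = completion \<nu>" "sets \<nu> = sets (restrict_space borel G)" "space \<nu> = G"
    "emeasure \<nu> G = 1"
    "\<And>x A. x \<in> G \<Longrightarrow> A \<in> sets \<nu> \<Longrightarrow> emeasure \<nu> (x <#\<^bsub>vgroup P\<^esub> A) = emeasure \<nu> A"
proof -
  obtain \<nu> where \<nu>: "\<mu> = completion \<nu>" "sets \<nu> = sets (restrict_space borel G)"
    "emeasure \<nu> G = 1"
    "\<forall>x\<in>G. \<forall>A\<in>sets \<nu>. emeasure \<nu> (x <#\<^bsub>vgroup P\<^esub> A) = emeasure \<nu> A"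
    using haar unfolding normalized_haar_def by blast
  have "space \<nu> = G" using sets_eq_imp_space_eq[OF \<nu>(2)] by (simp add: space_restrict_space)
  then show thesis using that \<nu> by blast
qed

lemma space_haar: "space \<mu> = G"
  by (rule haar_cases) simp

lemma emeasure_G: "emeasure \<mu> G = 1"
proof -
  obtain \<nu> where \<nu>: "\<mu> = completion \<nu>" "sets \<nu> = sets (restrict_space borel G)" "space \<nu> = G"
    "emeasure \<nu> G = 1"
    "\<And>x A. x \<in> G \<Longrightarrow> A \<in> sets \<nu> \<Longrightarrow> emeasure \<nu> (x <#\<^bsub>vgroup P\<^esub> A) = emeasure \<nu> A"
    by (rule haar_cases) blast
  have "G \<in> sets \<nu>" using sets.top[of \<nu>] by (simp add: \<nu>(3))
  then show ?thesis using \<nu>(4) by (simp add: \<nu>(1))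
qed

lemma finite_haar: "finite_measure \<mu>"
  by (rule finite_measureI) (simp add: space_haar emeasure_G)

lemma emeasure_haar_finite: "emeasure \<mu> A \<noteq> \<infinity>"
  using finite_measure.emeasure_finite[OF finite_haar] by simp

lemma open_sets_haar:
  assumes "open A"
  shows "A \<inter> G \<in> sets \<mu>"
proof -
  obtain \<nu> where \<nu>: "\<mu> = completion \<nu>" "sets \<nu> = sets (restrict_space borel G)" "space \<nu> = G"
    "emeasure \<nu> G = 1"
    "\<And>x A. x \<in> G \<Longrightarrow> A \<in> sets \<nu> \<Longrightarrow> emeasure \<nu> (x <#\<^bsub>vgroup P\<^esub> A) = emeasure \<nu> A"
    by (rule haar_cases) blast
  have "A \<inter> G \<in> sets \<nu>" using borel_open[OF assms] by (auto simp: \<nu>(2) sets_restrict_space)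
  then show ?thesis by (simp add: \<nu>(1))
qed

text \<open>The condition at \<open>k\<close> is cyclic, so an arc may wrap around zero. Only the
  coordinates of \<open>x\<close> up to \<open>k\<close> matter, and no group operation occurs;
  \<open>arc_eq_coset\<close> gives the link to translates.\<close>

definition arc :: "(nat \<Rightarrow> int) \<Rightarrow> nat \<Rightarrow> nat \<Rightarrow> (nat \<Rightarrow> int) set" where
  "arc x k j = {y \<in> G. (\<forall>i<k. y i = x i) \<and> (y k - x k) mod int (P k) < int j}"

lemma open_coordinate: "open {y :: nat \<Rightarrow> int. y i \<in> S}"
proof -
  have "open ((\<lambda>y :: nat \<Rightarrow> int. y i) -` S)"
    by (rule open_vimage[OF Topological_Spaces.open_discrete continuous_on_product_coordinates])
  then show ?thesis by (simp add: vimage_def)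
qed

lemma arc_relatively_open: "\<exists>A. open A \<and> arc x k j = A \<inter> G"
proof (intro exI conjI)
  let ?A = "(\<Inter>i\<in>{..<k}. {y. y i \<in> {x i}}) \<inter> {y. y k \<in> {v. (v - x k) mod int (P k) < int j}}"
  show "open ?A" by (intro open_Int open_INT ballI open_coordinate) simp
  show "arc x k j = ?A \<inter> G" by (auto simp: arc_def)
qed

lemma arc_sets [measurable]: "arc x k j \<in> sets \<mu>"
  using arc_relatively_open[of x k j] open_sets_haar by auto

lemma arc_eq_coset:
  assumes x: "x \<in> G"
  shows "arc x k j = x <#\<^bsub>vgroup P\<^esub> {y \<in> G. (\<forall>i<k. y i = 0) \<and> 0 \<le> y k \<and> y k < int j}"
    (is "_ = _ <#\<^bsub>_\<^esub> ?Y")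
proof (intro equalityI subsetI)
  fix z assume z: "z \<in> arc x k j"
  define y where "y i = (z i - x i) mod int (P i)" for i
  have zb: "0 \<le> z i" "z i < int (P i)" for i using z by (auto simp: arc_def in_G_iff)
  have "y \<in> G" using P_pos by (simp add: in_G_iff y_def)
  moreover have "y i = 0" if "i < k" for i using z that by (simp add: arc_def y_def)
  moreover have "0 \<le> y k" "y k < int j" using z P_pos[of k] by (auto simp: arc_def y_def)
  ultimately have "y \<in> ?Y" by simp
  moreover have "z = x \<otimes>\<^bsub>vgroup P\<^esub> y"
    using zb by (simp add: mult_vgroup y_def mod_add_right_eq fun_eq_iff)
  ultimately show "z \<in> x <#\<^bsub>vgroup P\<^esub> ?Y" by (auto simp: l_coset_def)
next
  fix z assume "z \<in> x <#\<^bsub>vgroup P\<^esub> ?Y"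
  then obtain y where y: "y \<in> ?Y" and z: "z = x \<otimes>\<^bsub>vgroup P\<^esub> y" by (auto simp: l_coset_def)
  have xb: "0 \<le> x i" "x i < int (P i)" for i using x by (auto simp: in_G_iff)
  have yb: "0 \<le> y i" "y i < int (P i)" for i using y by (auto simp: in_G_iff)
  have "z \<in> G" using P_pos by (simp add: in_G_iff z mult_vgroup)
  moreover have "z i = x i" if "i < k" for i using y that xb by (simp add: z mult_vgroup)
  moreover have "(z k - x k) mod int (P k) = y k"
    using yb[of k] by (simp add: z mult_vgroup mod_diff_left_eq)
  ultimately show "z \<in> arc x k j" using y by (simp add: arc_def)
qed

lemma zero_in_G: "(\<lambda>_. 0) \<in> G"
  using P_pos by (simp add: in_G_iff)

lemma arc_zero: "arc (\<lambda>_. 0) k j = {y \<in> G. (\<forall>i<k. y i = 0) \<and> 0 \<le> y k \<and> y k < int j}"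
  by (auto simp: arc_def in_G_iff)

lemma gen_intervals_eq: "gen_intervals P = {arc x k j | x k j. x \<in> G \<and> 1 \<le> j \<and> j \<le> P k}"
  unfolding gen_intervals_def by (intro Collect_cong ex_cong1) (auto simp: arc_eq_coset)

lemma emeasure_arc_translate:
  assumes x: "x \<in> G"
  shows "emeasure \<mu> (arc x k j) = emeasure \<mu> (arc (\<lambda>_. 0) k j)"
proof -
  obtain \<nu> where \<nu>: "\<mu> = completion \<nu>" "sets \<nu> = sets (restrict_space borel G)" "space \<nu> = G"
    "emeasure \<nu> G = 1"
    "\<And>x A. x \<in> G \<Longrightarrow> A \<in> sets \<nu> \<Longrightarrow> emeasure \<nu> (x <#\<^bsub>vgroup P\<^esub> A) = emeasure \<nu> A"
    by (rule haar_cases) blast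
  have sets: "arc y k j \<in> sets \<nu>" for y
  proof -
    obtain A where A: "open A" "arc y k j = A \<inter> G" using arc_relatively_open by blast
    have "G \<inter> A \<in> sets (restrict_space borel G)"
      unfolding sets_restrict_space using borel_open[OF A(1)] by (rule imageI)
    then show ?thesis unfolding \<nu>(2) A(2) by (simp only: Int_commute)
  qed
  have "emeasure \<nu> (arc x k j) = emeasure \<nu> (x <#\<^bsub>vgroup P\<^esub> arc (\<lambda>_. 0) k j)"
    by (simp only: arc_eq_coset[OF x] arc_zero)
  also have "\<dots> = emeasure \<nu> (arc (\<lambda>_. 0) k j)" by (rule \<nu>(5)[OF x sets])
  finally show ?thesis by (simp add: \<nu>(1) sets)
qed

lemma shift_in_G: "x \<in> G \<Longrightarrow> x(k := (x k + a) mod int (P k)) \<in> G"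
  using P_pos by (simp add: in_G_iff)

text \<open>In terms of the offset \<open>u = (v - x k) mod P k\<close> the two arcs are
  \<open>u < a\<close> and \<open>a \<le> u < a + b\<close>. The bound
  \<open>a + b \<le> P k\<close> keeps the second arc from wrapping into the first.\<close>

lemma arc_split:
  assumes "x \<in> G" "a + b \<le> P k"
  shows "arc x k (a + b) = arc x k a \<union> arc (x(k := (x k + int a) mod int (P k))) k b"
    and "arc x k a \<inter> arc (x(k := (x k + int a) mod int (P k))) k b = {}"
proof -
  let ?p = "int (P k)"
  have eq: "(v - (x k + int a) mod ?p) mod ?p < int b \<longleftrightarrow>
      int a \<le> (v - x k) mod ?p \<and> (v - x k) mod ?p < int (a + b)" for v
  proof -
    define u where "u = (v - x k) mod ?p"
    have u: "0 \<le> u" "u < ?p" using P_pos[of k] by (auto simp: u_def)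
    have "(v - (x k + int a) mod ?p) mod ?p = (u - int a) mod ?p"
      by (simp add: u_def mod_diff_left_eq mod_diff_right_eq diff_diff_eq)
    also have "\<dots> = (if int a \<le> u then u - int a else u - int a + ?p)"
    proof (cases "int a \<le> u")
      case False
      have "(u - int a) mod ?p = (u - int a + ?p) mod ?p" by simp
      also have "\<dots> = u - int a + ?p" using u False assms(2) by (intro mod_pos_pos_trivial) auto
      finally show ?thesis using False by simp
    qed (use u in simp)
    finally show ?thesis using u assms(2) unfolding u_def[symmetric] by auto
  qed
  show "arc x k (a + b) = arc x k a \<union> arc (x(k := (x k + int a) mod ?p)) k b"
    by (auto simp: arc_def eq)
  show "arc x k a \<inter> arc (x(k := (x k + int a) mod ?p)) k b = {}"
    by (auto simp: arc_def eq)
qed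

text \<open>Length one pins coordinate \<open>k\<close>, and length \<open>P (Suc k)\<close> leaves
  coordinate \<open>Suc k\<close> free: two labels of the same coset.\<close>

lemma arc_Suc: "x \<in> G \<Longrightarrow> arc x k 1 = arc x (Suc k) (P (Suc k))"
proof -
  assume x: "x \<in> G"
  have "(y k - x k) mod int (P k) < 1 \<longleftrightarrow> y k = x k" if "y \<in> G" for y
  proof
    assume "(y k - x k) mod int (P k) < 1"
    then have "(y k - x k) mod int (P k) = 0"
      using pos_mod_sign[of "int (P k)" "y k - x k"] P_pos[of k] by linarith
    then have "y k mod int (P k) = x k mod int (P k)" by (simp add: mod_eq_dvd_iff mod_0_imp_dvd)
    then show "y k = x k" using x that by (simp add: in_G_iff)
  qed simp
  moreover have "(y (Suc k) - x (Suc k)) mod int (P (Suc k)) < int (P (Suc k))" for y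
    using P_pos by simp
  ultimately show ?thesis by (auto simp: arc_def less_Suc_eq)
qed

lemma arc_full: "arc x 0 (P 0) = G"
  using P_pos by (auto simp: arc_def)

section \<open>Measures of arcs\<close>

definition unit_mass :: "nat \<Rightarrow> real" where
  "unit_mass k = measure \<mu> (arc (\<lambda>_. 0) k 1)"

lemma measure_arc_translate: "x \<in> G \<Longrightarrow> measure \<mu> (arc x k j) = measure \<mu> (arc (\<lambda>_. 0) k j)"
  by (simp add: measure_def emeasure_arc_translate)

text \<open>Arcs of length one are peeled off the end; by translation invariance all of them have
  the same mass.\<close>

lemma measure_arc: "x \<in> G \<Longrightarrow> j \<le> P k \<Longrightarrow> measure \<mu> (arc x k j) = real j * unit_mass k"
proof (induction j)
  case 0
  have "arc x k 0 = {}" using P_pos[of k] by (auto simp: arc_def not_less)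
  then show ?case by simp
next
  case (Suc j)
  let ?x = "x(k := (x k + int j) mod int (P k))"
  have "measure \<mu> (arc x k j \<union> arc ?x k 1) = measure \<mu> (arc x k j) + measure \<mu> (arc ?x k 1)"
    using arc_split(2)[of x j 1 k] Suc.prems emeasure_haar_finite
    by (intro measure_Union) auto
  moreover have "measure \<mu> (arc ?x k 1) = unit_mass k"
    unfolding unit_mass_def by (rule measure_arc_translate[OF shift_in_G[OF Suc.prems(1)]])
  ultimately show ?case
    using arc_split(1)[of x j 1 k] Suc by (simp add: algebra_simps)
qed

text \<open>Positivity descends from the total mass one, since a coset of level \<open>k\<close>
  splits into \<open>P (Suc k)\<close> translates of one coset of the next level.\<close>

lemma unit_mass_pos: "0 < unit_mass k"
proof (induction k)
  case 0
  have "real (P 0) * unit_mass 0 = 1"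
    using measure_arc[OF zero_in_G, of "P 0" 0] emeasure_G by (simp add: arc_full measure_def)
  then show ?case using P_pos[of 0] by (metis of_nat_0_less_iff zero_less_mult_pos zero_less_one)
next
  case (Suc k)
  have "unit_mass k = real (P (Suc k)) * unit_mass (Suc k)"
    using measure_arc[OF zero_in_G, of "P (Suc k)" "Suc k"] arc_Suc[OF zero_in_G, of k]
    by (simp add: unit_mass_def)
  then show ?case using Suc P_pos[of "Suc k"] by (metis of_nat_0_less_iff zero_less_mult_pos)
qed

section \<open>The binary tree of arcs\<close>

definition arc_of :: "(nat \<Rightarrow> int) \<times> nat \<times> nat \<Rightarrow> (nat \<Rightarrow> int) set" where
  "arc_of t = (case t of (x, k, j) \<Rightarrow> arc x k j)"

definition indices :: "((nat \<Rightarrow> int) \<times> nat \<times> nat) set" where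
  "indices = {(x, k, j). x \<in> G \<and> 1 \<le> j \<and> j \<le> P k}"

text \<open>A single coset is split as the full arc of the next level; this is what keeps both
  halves comparable to the whole although the orders \<open>P k\<close> are unbounded.\<close>

definition refine :: "(nat \<Rightarrow> int) \<times> nat \<times> nat \<Rightarrow> (nat \<Rightarrow> int) \<times> nat \<times> nat" where
  "refine t = (case t of (x, k, j) \<Rightarrow> if j = 1 then (x, Suc k, P (Suc k)) else (x, k, j))"

definition left_half :: "(nat \<Rightarrow> int) \<times> nat \<times> nat \<Rightarrow> (nat \<Rightarrow> int) \<times> nat \<times> nat" where
  "left_half t = (case refine t of (x, k, j) \<Rightarrow> (x, k, j div 2))"

definition right_half :: "(nat \<Rightarrow> int) \<times> nat \<times> nat \<Rightarrow> (nat \<Rightarrow> int) \<times> nat \<times> nat" where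
  "right_half t = (case refine t of (x, k, j) \<Rightarrow>
     (x(k := (x k + int (j div 2)) mod int (P k)), k, j - j div 2))"

text \<open>After refinement the length is at least two, so both halves are nonempty; at a new level
  this is \<open>2 \<le> P (Suc k)\<close>.\<close>

lemma refine_cases:
  assumes "t \<in> indices"
  obtains x k j where "refine t = (x, k, j)" "x \<in> G" "2 \<le> j" "j \<le> P k" "arc_of t = arc x k j"
proof (cases t)
  case (fields x k j)
  then have t: "x \<in> G" "1 \<le> j" "j \<le> P k" using assms by (auto simp: indices_def)
  show thesis
  proof (cases "j = 1")
    case True
    show thesis
      by (rule that[of x "Suc k" "P (Suc k)"])
        (use True fields t P2[of "Suc k"] arc_Suc[OF t(1), of k] in \<open>simp_all add: refine_def arc_of_def\<close>)
  next
    case False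
    show thesis
      by (rule that[of x k j]) (use False fields t in \<open>simp_all add: refine_def arc_of_def\<close>)
  qed
qed

sublocale binary_partition \<mu> indices arc_of left_half right_half
proof
  fix t assume t: "t \<in> indices"
  then obtain x k j where r: "refine t = (x, k, j)" "x \<in> G" "2 \<le> j" "j \<le> P k" "arc_of t = arc x k j"
    by (rule refine_cases)
  let ?x = "x(k := (x k + int (j div 2)) mod int (P k))"
  have lr: "left_half t = (x, k, j div 2)" "right_half t = (?x, k, j - j div 2)"
    by (simp_all add: left_half_def right_half_def r(1))
  have x': "?x \<in> G" by (rule shift_in_G[OF r(2)])
  show "left_half t \<in> indices" "right_half t \<in> indices"
    using r x' by (auto simp: lr indices_def)
  show "arc_of t \<in> sets \<mu>" by (simp add: r(5))
  show "emeasure \<mu> (arc_of t) \<noteq> top" using emeasure_haar_finite by simp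
  show "0 < measure \<mu> (arc_of t)"
    using r unit_mass_pos[of k] by (simp add: measure_arc)
  show "arc_of t = arc_of (left_half t) \<union> arc_of (right_half t)"
    "arc_of (left_half t) \<inter> arc_of (right_half t) = {}"
    using arc_split[OF r(2), of "j div 2" "j - j div 2" k] r by (simp_all add: lr arc_of_def)
  \<comment> \<open>Odd lengths cannot be halved exactly; the worst case \<open>j = 3\<close> splits
    into 1 and 2, which is where the constant 3 originates.\<close>
  have "j \<le> 3 * (j div 2)" "j \<le> 3 * (j - j div 2)" using r(3) by presburger+
  then have "real j \<le> real (3 * (j div 2))" "real j \<le> real (3 * (j - j div 2))"
    by (simp_all only: of_nat_le_iff)
  then have "real j * unit_mass k \<le> 3 * real (j div 2) * unit_mass k"
    "real j * unit_mass k \<le> 3 * real (j - j div 2) * unit_mass k"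
    using unit_mass_pos[of k] by (simp_all only: of_nat_mult of_nat_numeral mult_right_mono less_imp_le)
  moreover have "measure \<mu> (arc_of t) = real j * unit_mass k"
    "measure \<mu> (arc_of (left_half t)) = real (j div 2) * unit_mass k"
    "measure \<mu> (arc_of (right_half t)) = real (j - j div 2) * unit_mass k"
    using r x' by (auto simp: lr arc_of_def measure_arc)
  ultimately show "measure \<mu> (arc_of t) \<le> 3 * measure \<mu> (arc_of (left_half t))"
    "measure \<mu> (arc_of t) \<le> 3 * measure \<mu> (arc_of (right_half t))" by (simp_all only: mult.assoc)
qed

text \<open>Induction on the length: a longer arc passes to a strictly shorter one on the same
  level, and an arc of length one moves to the next level.\<close>

lemma node_level_increases:
  assumes "t \<in> indices"
  shows "\<exists>n. fst (snd t) < fst (snd (node n t x))"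
  using assms
proof (induction "snd (snd t)" arbitrary: t rule: less_induct)
  case less
  define c where "c = (if x \<in> arc_of (left_half t) then left_half t else right_half t)"
  have c: "c \<in> indices" using less.prems L_in R_in by (simp add: c_def)
  have step: "node (Suc n) t x = node n c x" for n by (simp add: c_def)
  obtain y k j where t: "t = (y, k, j)" by (cases t)
  show ?case
  proof (cases "j = 1")
    case True
    then have "fst (snd t) < fst (snd (node (Suc 0) t x))"
      by (simp add: t left_half_def right_half_def refine_def)
    then show ?thesis by blast
  next
    case False
    then have "snd (snd c) < snd (snd t)" "fst (snd c) = fst (snd t)"
      using less.prems by (auto simp: t c_def left_half_def right_half_def refine_def indices_def)
    with less.hyps[OF this(1) c] obtain n where "fst (snd t) < fst (snd (node n c x))" by auto
    then show ?thesis unfolding step[symmetric] by blast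
  qed
qed

lemma node_level_unbounded:
  assumes "t \<in> indices"
  shows "\<exists>n. N \<le> fst (snd (node n t x))"
proof (induction N)
  case (Suc N)
  then obtain n where n: "N \<le> fst (snd (node n t x))" by blast
  obtain m where "fst (snd (node n t x)) < fst (snd (node m (node n t x) x))"
    using node_level_increases[OF node_in[OF assms]] by blast
  then have "Suc N \<le> fst (snd (node (n + m) t x))" using n by (simp add: node_add)
  then show ?case by blast
qed simp

text \<open>The measure is transported to real sequences, a Polish space, where finite Borel
  measures are outer regular. An open set there contains a cylinder around each of its points, and
  every branch of the tree eventually enters that cylinder.\<close>

lemma outer_approximation:
  assumes t: "t \<in> indices" and E: "E \<in> sets \<mu>" and e: "0 < e"
  shows "\<exists>U\<in>sets \<mu>. E \<subseteq> U \<and> emeasure \<mu> U \<le> emeasure \<mu> E + ennreal e \<and>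
    (\<forall>x\<in>U \<inter> arc_of t. \<exists>n. arc_of (node n t x) \<subseteq> U)"
proof -
  obtain \<nu> where \<nu>: "\<mu> = completion \<nu>" "sets \<nu> = sets (restrict_space borel G)" "space \<nu> = G"
    "emeasure \<nu> G = 1"
    "\<And>x A. x \<in> G \<Longrightarrow> A \<in> sets \<nu> \<Longrightarrow> emeasure \<nu> (x <#\<^bsub>vgroup P\<^esub> A) = emeasure \<nu> A"
    by (rule haar_cases) blast
  \<comment> \<open>The Haar measure is a completion, so \<open>E\<close> is first enlarged to a
    Borel set of equal measure.\<close>
  have "\<exists>A\<in>sets \<nu>. E \<subseteq> A \<and> emeasure \<mu> E = emeasure \<nu> A"
    using E unfolding \<nu>(1) by (rule completion_upper) blast
  then obtain A where A: "A \<in> sets \<nu>" "E \<subseteq> A" "emeasure \<mu> E = emeasure \<nu> A"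
    by (elim bexE conjE)
  have "A \<in> (\<inter>) G ` sets borel" using A(1) unfolding \<nu>(2) sets_restrict_space .
  then obtain B where B: "B \<in> sets borel" "A = G \<inter> B" by (rule imageE)
  have int_borel: "sets (borel :: int measure) = sets (count_space UNIV)"
    by (rule sets_borel_eq_count_space)
  define \<Phi> :: "(nat \<Rightarrow> int) \<Rightarrow> nat \<Rightarrow> real" where "\<Phi> y i = real_of_int (y i)" for y i
  have \<Phi>1: "\<Phi> \<in> borel_measurable (borel :: (nat \<Rightarrow> int) measure)"
  proof (rule measurable_coordinatewise_then_product)
    fix i
    have "(\<lambda>y :: nat \<Rightarrow> int. y i) \<in> borel_measurable borel"
      by (intro borel_measurable_continuous_onI continuous_on_product_coordinates)
    then have "(\<lambda>y :: nat \<Rightarrow> int. y i) \<in> measurable borel (count_space UNIV)"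
      using measurable_cong_sets[OF refl int_borel] by blast
    then show "(\<lambda>y. \<Phi> y i) \<in> borel_measurable borel"
      unfolding \<Phi>_def by (rule measurable_compose) simp
  qed
  then have \<Phi>: "\<Phi> \<in> borel_measurable \<nu>"
    using measurable_restrict_space1[OF \<Phi>1, of G] measurable_cong_sets[OF \<nu>(2) refl] by blast
  \<comment> \<open>Rounding down is a Borel left inverse of \<open>\<Phi>\<close>, so
    \<open>B'\<close> is Borel and its preimage under \<open>\<Phi>\<close> is exactly
    \<open>A\<close>.\<close>
  define \<Psi> :: "(nat \<Rightarrow> real) \<Rightarrow> nat \<Rightarrow> int" where "\<Psi> z i = \<lfloor>z i\<rfloor>" for z i
  have \<Psi>: "\<Psi> \<in> borel_measurable (borel :: (nat \<Rightarrow> real) measure)"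
  proof (rule measurable_coordinatewise_then_product)
    fix i
    have "(\<lambda>z :: nat \<Rightarrow> real. z i) \<in> borel_measurable borel"
      by (intro borel_measurable_continuous_onI continuous_on_product_coordinates)
    then have "(\<lambda>z. \<lfloor>z i\<rfloor>) \<in> measurable (borel :: (nat \<Rightarrow> real) measure) (count_space UNIV)" by measurable
    then show "(\<lambda>z. \<Psi> z i) \<in> borel_measurable borel"
      unfolding \<Psi>_def using measurable_cong_sets[OF refl int_borel] by blast
  qed
  define N where "N = distr \<nu> borel \<Phi>"
  define B' where "B' = \<Psi> -` B"
  have B': "B' \<in> sets borel" using measurable_sets[OF \<Psi> B(1)] by (simp add: B'_def)
  have inv: "\<Psi> (\<Phi> y) = y" for y by (simp add: \<Phi>_def \<Psi>_def fun_eq_iff)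
  have "\<Phi> -` B' \<inter> space \<nu> = A" by (auto simp: B'_def B(2) \<nu>(3) inv)
  then have NB: "emeasure N B' = emeasure \<mu> E"
    using emeasure_distr[OF \<Phi> B'] by (simp add: N_def A(3))
  have Nfin: "emeasure N (space N) \<noteq> \<infinity>"
    using emeasure_distr[OF \<Phi>, of UNIV] \<nu>(3,4) by (simp add: N_def)
  have "emeasure N B' < emeasure \<mu> E + ennreal e"
    using NB e emeasure_haar_finite[of E] by (cases "emeasure \<mu> E") (auto simp: ennreal_less_iff simp flip: ennreal_plus)
  then have "(INF V\<in>{V. B' \<subseteq> V \<and> open V}. emeasure N V) < emeasure \<mu> E + ennreal e"
    using outer_regular[OF _ Nfin B'] by (simp add: N_def)
  then obtain W where W: "B' \<subseteq> W" "open W" "emeasure N W < emeasure \<mu> E + ennreal e"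
    by (auto simp: INF_less_iff)
  define U where "U = \<Phi> -` W \<inter> G"
  have U: "U \<in> sets \<nu>" using measurable_sets[OF \<Phi> borel_open[OF W(2)]] by (simp add: U_def \<nu>(3))
  have "emeasure \<mu> U = emeasure N W"
    using U emeasure_distr[OF \<Phi> borel_open[OF W(2)]] by (simp add: N_def U_def \<nu>(1,3))
  then have 1: "emeasure \<mu> U \<le> emeasure \<mu> E + ennreal e" using W(3) by simp
  have 2: "E \<subseteq> U"
  proof
    fix y assume "y \<in> E"
    then have y: "y \<in> B" "y \<in> G" using A(2) B(2) by auto
    then have "\<Phi> y \<in> B'" by (simp add: B'_def inv)
    then show "y \<in> U" using W(1) y by (auto simp: U_def)
  qed
  have 3: "\<exists>n. arc_of (node n t x) \<subseteq> U" if x: "x \<in> U \<inter> arc_of t" for x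
  proof -
    have "\<Phi> x \<in> W" using x by (simp add: U_def)
    then obtain k where k: "\<And>z. (\<forall>i<k. z i = \<Phi> x i) \<Longrightarrow> z \<in> W"
      using open_contains_cylinder[OF W(2)] by blast
    \<comment> \<open>At level \<open>k\<close> or beyond, all points of the arc share the first
      \<open>k\<close> coordinates with \<open>x\<close>, so their images lie in the cylinder inside
      \<open>W\<close>.\<close>
    obtain n where n: "k \<le> fst (snd (node n t x))" using node_level_unbounded[OF t] by blast
    obtain y l j where nd: "node n t x = (y, l, j)" by (cases "node n t x")
    have xn: "x \<in> arc y l j" using in_D_node[OF t, of x n] x by (simp add: nd arc_of_def)
    have "arc y l j \<subseteq> U"
    proof
      fix z assume z: "z \<in> arc y l j"
      then have "\<forall>i<k. z i = x i" using xn n nd by (simp add: arc_def)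
      then have "\<Phi> z \<in> W" by (intro k) (simp add: \<Phi>_def)
      then show "z \<in> U" using z by (simp add: U_def arc_def)
    qed
    then show ?thesis by (intro exI[of _ n]) (simp add: nd arc_of_def)
  qed
  show ?thesis using U 1 2 3 by (intro bexI[of _ U]) (auto simp: \<nu>(1))
qed

section \<open>The maximal operator\<close>

text \<open>Extended values are accepted as input so that the operator can be iterated and applied
  to powers and infinite sums.\<close>

definition avg_maximal :: "((nat \<Rightarrow> int) \<Rightarrow> ennreal) \<Rightarrow> (nat \<Rightarrow> int) \<Rightarrow> ennreal" where
  "avg_maximal f x = (SUP I\<in>{I \<in> gen_intervals P. x \<in> I}. (\<integral>\<^sup>+y\<in>I. f y \<partial>\<mu>) / emeasure \<mu> I)"

lemma maximal_fun_eq: "maximal_fun P \<mu> f = avg_maximal (\<lambda>x. ennreal \<bar>f x\<bar>)"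
  by (simp add: fun_eq_iff maximal_fun_def avg_maximal_def)

lemma gen_intervals_eq_image: "gen_intervals P = arc_of ` indices"
  by (force simp: gen_intervals_eq indices_def arc_of_def)

lemma gen_intervals_sets: "I \<in> gen_intervals P \<Longrightarrow> I \<in> sets \<mu>"
  using sets_D by (auto simp: gen_intervals_eq_image)

lemma emeasure_gen_interval:
  assumes "I \<in> gen_intervals P"
  shows "0 < emeasure \<mu> I" "emeasure \<mu> I < top"
proof -
  obtain t where t: "t \<in> indices" "I = arc_of t" using assms by (auto simp: gen_intervals_eq_image)
  show "0 < emeasure \<mu> I" using D_pos[OF t(1)] by (auto simp: t(2) measure_def zero_less_iff_neq_zero)
  show "emeasure \<mu> I < top" using emeasure_haar_finite[of I] by (simp add: less_top)
qed

text \<open>An arc of level \<open>k\<close> depends only on coordinates \<open>0\<close> to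
  \<open>k\<close> of its base point, so a finite list encodes it.\<close>

lemma countable_gen_intervals: "countable (gen_intervals P)"
proof (rule countable_subset)
  let ?F = "\<lambda>(l :: int list, k, j). arc (\<lambda>i. if i < length l then l ! i else 0) k j"
  show "countable (range ?F)" by simp
  show "gen_intervals P \<subseteq> range ?F"
  proof
    fix I assume "I \<in> gen_intervals P"
    then obtain x k j where I: "I = arc x k j" by (auto simp: gen_intervals_eq)
    have "I = ?F (map x [0..<Suc k], k, j)"
      by (auto simp: I arc_def nth_append simp del: upt_Suc)
    then show "I \<in> range ?F" by blast
  qed
qed

lemma average_le_avg_maximal:
  "I \<in> gen_intervals P \<Longrightarrow> x \<in> I \<Longrightarrow> (\<integral>\<^sup>+y\<in>I. f y \<partial>\<mu>) / emeasure \<mu> I \<le> avg_maximal f x"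
  unfolding avg_maximal_def by (rule SUP_upper) simp

lemma avg_maximal_leI:
  "(\<And>I. I \<in> gen_intervals P \<Longrightarrow> x \<in> I \<Longrightarrow> (\<integral>\<^sup>+y\<in>I. f y \<partial>\<mu>) / emeasure \<mu> I \<le> B)
    \<Longrightarrow> avg_maximal f x \<le> B"
  unfolding avg_maximal_def by (rule SUP_least) auto

text \<open>Whatever \<open>f\<close> is, each interval contributes a constant times an indicator,
  and there are only countably many intervals.\<close>

lemma avg_maximal_measurable [measurable]: "avg_maximal f \<in> borel_measurable \<mu>"
proof -
  let ?a = "\<lambda>I. (\<integral>\<^sup>+y\<in>I. f y \<partial>\<mu>) / emeasure \<mu> I"
  have "avg_maximal f x = (SUP I\<in>gen_intervals P. ?a I * indicator I x)" for x
  proof (rule antisym)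
    show "avg_maximal f x \<le> (SUP I\<in>gen_intervals P. ?a I * indicator I x)"
      by (rule avg_maximal_leI) (auto intro: SUP_upper2)
    show "(SUP I\<in>gen_intervals P. ?a I * indicator I x) \<le> avg_maximal f x"
      by (rule SUP_least) (auto simp: average_le_avg_maximal split: split_indicator)
  qed
  moreover have "(\<lambda>x. SUP I\<in>gen_intervals P. ?a I * indicator I x) \<in> borel_measurable \<mu>"
    using gen_intervals_sets by (intro borel_measurable_SUP countable_gen_intervals) auto
  ultimately show ?thesis by (simp cong: measurable_cong)
qed

lemma avg_maximal_mono:
  assumes "\<And>x. f x \<le> g x"
  shows "avg_maximal f x \<le> avg_maximal g x"
  unfolding avg_maximal_def
  by (intro SUP_mono' divide_right_mono_ennreal nn_integral_mono mult_right_mono assms) simp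

lemma avg_maximal_cong_AE:
  assumes "AE x in \<mu>. f x = g x"
  shows "avg_maximal f = avg_maximal g"
proof -
  have "(\<integral>\<^sup>+y\<in>I. f y \<partial>\<mu>) = (\<integral>\<^sup>+y\<in>I. g y \<partial>\<mu>)" for I
    by (rule nn_integral_cong_AE) (use assms in auto)
  then show ?thesis by (simp add: avg_maximal_def fun_eq_iff)
qed

lemma avg_maximal_cmult:
  assumes [measurable]: "f \<in> borel_measurable \<mu>"
  shows "avg_maximal (\<lambda>x. c * f x) x = c * avg_maximal f x"
proof -
  have "(\<integral>\<^sup>+y\<in>I. (c * f y) \<partial>\<mu>) / emeasure \<mu> I = c * ((\<integral>\<^sup>+y\<in>I. f y \<partial>\<mu>) / emeasure \<mu> I)"
    if "I \<in> gen_intervals P" for I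
  proof -
    have [measurable]: "I \<in> sets \<mu>" by (rule gen_intervals_sets[OF that])
    show ?thesis by (simp add: mult.assoc nn_integral_cmult ennreal_times_divide)
  qed
  then show ?thesis
    unfolding avg_maximal_def SUP_mult_left_ennreal by (intro SUP_cong) auto
qed

lemma avg_maximal_divide:
  assumes "f \<in> borel_measurable \<mu>"
  shows "avg_maximal (\<lambda>x. f x / c) x = avg_maximal f x / c"
  using avg_maximal_cmult[OF assms, of "inverse c" x] by (simp add: divide_ennreal_def mult.commute)

lemma avg_maximal_suminf:
  assumes [measurable]: "\<And>k. f k \<in> borel_measurable \<mu>"
  shows "avg_maximal (\<lambda>x. \<Sum>k. f k x) x \<le> (\<Sum>k. avg_maximal (f k) x)"
proof (rule avg_maximal_leI)
  fix I assume I: "I \<in> gen_intervals P" "x \<in> I"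
  have [measurable]: "I \<in> sets \<mu>" by (rule gen_intervals_sets[OF I(1)])
  have "(\<integral>\<^sup>+y\<in>I. (\<Sum>k. f k y) \<partial>\<mu>) = (\<integral>\<^sup>+y. (\<Sum>k. f k y * indicator I y) \<partial>\<mu>)" by simp
  also have "\<dots> = (\<Sum>k. \<integral>\<^sup>+y\<in>I. f k y \<partial>\<mu>)" by (rule nn_integral_suminf) measurable
  finally have "(\<integral>\<^sup>+y\<in>I. (\<Sum>k. f k y) \<partial>\<mu>) / emeasure \<mu> I
      = (\<Sum>k. (\<integral>\<^sup>+y\<in>I. f k y \<partial>\<mu>) / emeasure \<mu> I)"
    by (simp add: divide_ennreal_def)
  also have "\<dots> \<le> (\<Sum>k. avg_maximal (f k) x)"
    by (intro suminf_le average_le_avg_maximal I) auto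
  finally show "(\<integral>\<^sup>+y\<in>I. (\<Sum>k. f k y) \<partial>\<mu>) / emeasure \<mu> I \<le> (\<Sum>k. avg_maximal (f k) x)" .
qed

text \<open>In place of Jensen's inequality: \<open>v \<le> b + b powr (1 - s) * v powr s\<close>
  for every \<open>b > 0\<close>, trivially if \<open>v \<le> b\<close> and by monotonicity of the
  power \<open>s - 1\<close> otherwise. Averaging with \<open>b powr s \<ge> y\<close> gives
  \<open>2 * b\<close>.\<close>

lemma avg_maximal_le_powr:
  assumes s: "1 \<le> s" and [measurable]: "g \<in> borel_measurable \<mu>"
  shows "avg_maximal g x \<le> 2 * ennreal_powr (avg_maximal (\<lambda>x. ennreal_powr (g x) s) x) (1 / s)"
proof (cases "avg_maximal (\<lambda>x. ennreal_powr (g x) s) x")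
  case top
  then show ?thesis by (simp add: ennreal_mult_top)
next
  case (real y)
  have le: "avg_maximal g x \<le> ennreal (2 * b)" if b: "0 < b" "y \<le> b powr s" for b
  proof (rule avg_maximal_leI)
    fix I assume I: "I \<in> gen_intervals P" "x \<in> I"
    have [measurable]: "I \<in> sets \<mu>" by (rule gen_intervals_sets[OF I(1)])
    have pw: "g z \<le> ennreal b + ennreal (b powr (1 - s)) * ennreal_powr (g z) s" for z
    proof (cases "g z")
      case (real v)
      have "v \<le> b + b powr (1 - s) * v powr s"
      proof (cases "v \<le> b")
        case False
        then have "v = b powr (1 - s) * (v * b powr (s - 1))"
          using b by (simp flip: powr_add)
        also have "v * b powr (s - 1) \<le> v * v powr (s - 1)"
          using False b s by (intro mult_left_mono powr_mono2) auto
        also have "v * v powr (s - 1) = v powr s"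
          using False b by (simp add: powr_mult_base)
        finally show ?thesis using b by (simp add: mult_left_mono)
      qed (simp add: add_increasing2)
      then have "ennreal v \<le> ennreal (b + b powr (1 - s) * v powr s)" by (rule ennreal_leI)
      then show ?thesis using real b by (simp add: ennreal_powr_ennreal ennreal_mult)
    qed (use b in \<open>simp add: ennreal_mult_top\<close>)
    have "(\<integral>\<^sup>+z\<in>I. g z \<partial>\<mu>) \<le> (\<integral>\<^sup>+z. ennreal b * indicator I z
        + ennreal (b powr (1 - s)) * (ennreal_powr (g z) s * indicator I z) \<partial>\<mu>)"
      using pw by (intro nn_integral_mono) (auto split: split_indicator)
    also have "\<dots> = ennreal b * emeasure \<mu> I
        + ennreal (b powr (1 - s)) * (\<integral>\<^sup>+z\<in>I. ennreal_powr (g z) s \<partial>\<mu>)"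
      by (simp add: nn_integral_add nn_integral_cmult)
    finally have "(\<integral>\<^sup>+z\<in>I. g z \<partial>\<mu>) / emeasure \<mu> I \<le> (ennreal b * emeasure \<mu> I
        + ennreal (b powr (1 - s)) * (\<integral>\<^sup>+z\<in>I. ennreal_powr (g z) s \<partial>\<mu>)) / emeasure \<mu> I"
      by (rule divide_right_mono_ennreal)
    also have "\<dots> = ennreal b * emeasure \<mu> I / emeasure \<mu> I
        + ennreal (b powr (1 - s)) * ((\<integral>\<^sup>+z\<in>I. ennreal_powr (g z) s \<partial>\<mu>) / emeasure \<mu> I)"
      by (simp add: divide_ennreal_def distrib_right mult.assoc)
    also have "ennreal b * emeasure \<mu> I / emeasure \<mu> I = ennreal b"
      using emeasure_gen_interval[OF I(1)] by (intro ennreal_mult_divide_eq) auto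
    also have "ennreal b + ennreal (b powr (1 - s)) * ((\<integral>\<^sup>+z\<in>I. ennreal_powr (g z) s \<partial>\<mu>) / emeasure \<mu> I)
        \<le> ennreal b + ennreal (b powr (1 - s)) * ennreal (b powr s)"
    proof (intro add_left_mono mult_left_mono)
      have "(\<integral>\<^sup>+z\<in>I. ennreal_powr (g z) s \<partial>\<mu>) / emeasure \<mu> I \<le> ennreal y"
        using average_le_avg_maximal[OF I, of "\<lambda>z. ennreal_powr (g z) s"] real by simp
      also have "\<dots> \<le> ennreal (b powr s)" by (rule ennreal_leI[OF b(2)])
      finally show "(\<integral>\<^sup>+z\<in>I. ennreal_powr (g z) s \<partial>\<mu>) / emeasure \<mu> I \<le> ennreal (b powr s)" .
    qed simp
    also have "ennreal b + ennreal (b powr (1 - s)) * ennreal (b powr s) = ennreal (2 * b)"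
      using b by (simp flip: ennreal_mult ennreal_plus powr_add)
    finally show "(\<integral>\<^sup>+z\<in>I. g z \<partial>\<mu>) / emeasure \<mu> I \<le> ennreal (2 * b)" .
  qed
  have "avg_maximal g x \<le> ennreal (2 * y powr (1 / s))"
  proof (rule ennreal_le_epsilon)
    \<comment> \<open>The choice \<open>b = y powr (1 / s)\<close> may be zero, so it is approached
      from above.\<close>
    fix e :: real assume e: "0 < e"
    have "y = (y powr (1 / s)) powr s" using s real by (simp add: powr_powr)
    also have "\<dots> \<le> (y powr (1 / s) + e / 2) powr s" using s e by (intro powr_mono2) auto
    finally have "avg_maximal g x \<le> ennreal (2 * (y powr (1 / s) + e / 2))"
      using e by (intro le) (auto simp: add_nonneg_pos)
    also have "\<dots> = ennreal (2 * y powr (1 / s)) + ennreal e"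
      using e by (simp flip: ennreal_plus add: algebra_simps)
    finally show "avg_maximal g x \<le> ennreal (2 * y powr (1 / s)) + ennreal e" .
  qed
  then show ?thesis using real by (simp add: ennreal_powr_ennreal ennreal_mult)
qed

text \<open>Norm boundedness, up to the value of the constant: working with modulars avoids the
  infimum in the norm.\<close>

definition modular_bounded :: "((nat \<Rightarrow> int) \<Rightarrow> real) \<Rightarrow> real \<Rightarrow> bool" where
  "modular_bounded q C \<longleftrightarrow> (\<forall>f\<in>borel_measurable \<mu>. var_modular \<mu> q f \<le> 1 \<longrightarrow>
     var_modular \<mu> q (\<lambda>x. avg_maximal f x / ennreal C) \<le> 1)"

text \<open>A function of finite modular is finite almost everywhere, hence agrees almost everywhere
  with a real function, and averages ignore null sets. Doubling the constant gives the strict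
  inequality that \<open>var_norm_less_imp_modular\<close> asks for.\<close>

lemma maximal_bounded_on_imp_modular_bounded:
  assumes b: "maximal_bounded_on P \<mu> q" and [measurable]: "q \<in> borel_measurable \<mu>"
    and q: "\<And>x. x \<in> G \<Longrightarrow> 0 \<le> q x"
  shows "\<exists>C\<ge>1. modular_bounded q C"
proof -
  obtain C0 :: real where C0: "\<And>f. f \<in> var_Lebesgue \<mu> q \<Longrightarrow>
      var_norm \<mu> q (maximal_fun P \<mu> f) \<le> ennreal C0 * var_norm \<mu> q (\<lambda>x. ennreal \<bar>f x\<bar>)"
    using b unfolding maximal_bounded_on_def by blast
  \<comment> \<open>The given constant may be zero or negative; positivity is what makes
    \<open>C < 2 * C\<close> strict.\<close>
  define C where "C = max C0 1"
  have C1: "1 \<le> C" by (simp add: C_def)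
  have "modular_bounded q (2 * C)"
    unfolding modular_bounded_def
  proof (intro ballI impI)
    fix f assume [measurable]: "f \<in> borel_measurable \<mu>" and f: "var_modular \<mu> q f \<le> 1"
    define h where "h x = enn2real (f x)" for x
    have "AE x in \<mu>. f x \<noteq> top" using f by (intro var_modular_finite_AE[of f \<mu> q 1]) auto
    then have ae: "AE x in \<mu>. ennreal \<bar>h x\<bar> = f x"
      by eventually_elim (simp add: h_def less_top)
    have hmod: "var_modular \<mu> q (\<lambda>x. ennreal \<bar>h x\<bar> / ennreal 1) \<le> 1"
      using f var_modular_cong_AE[OF ae, of q] by simp
    have hL: "h \<in> var_Lebesgue \<mu> q"
    proof -
      have "h \<in> borel_measurable \<mu>" unfolding h_def by measurable
      moreover have "var_modular \<mu> q (\<lambda>x. ennreal \<bar>h x\<bar> / ennreal 1) < \<infinity>"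
        using hmod by (rule order_le_less_trans) simp
      ultimately show ?thesis unfolding var_Lebesgue_def by (blast intro: zero_less_one)
    qed
    have "var_norm \<mu> q (maximal_fun P \<mu> h) \<le> ennreal C0 * var_norm \<mu> q (\<lambda>x. ennreal \<bar>h x\<bar>)"
      by (rule C0[OF hL])
    also have "\<dots> \<le> ennreal C * ennreal 1"
      using hmod by (intro mult_mono var_norm_le ennreal_leI) (auto simp: C_def)
    also have "\<dots> < ennreal (2 * C)"
      using C1 by (simp add: ennreal_less_iff)
    finally have "var_modular \<mu> q (\<lambda>x. maximal_fun P \<mu> h x / ennreal (2 * C)) \<le> 1"
      by (intro var_norm_less_imp_modular) (auto simp: space_haar q)
    then show "var_modular \<mu> q (\<lambda>x. avg_maximal f x / ennreal (2 * C)) \<le> 1"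
      by (simp add: maximal_fun_eq avg_maximal_cong_AE[OF ae])
  qed
  then show ?thesis by (intro exI[of _ "2 * C"]) (auto simp: C_def)
qed

text \<open>By homogeneity, each \<open>t\<close> admissible for \<open>f\<close> makes
  \<open>C * t\<close> admissible for the maximal function. Dividing by \<open>C\<close> first
  leaves a lower bound for all such \<open>t\<close>, hence for their infimum.\<close>

lemma modular_bounded_imp_maximal_bounded_on:
  assumes b: "modular_bounded q C" and C: "0 < C"
  shows "maximal_bounded_on P \<mu> q"
  unfolding maximal_bounded_on_def
proof (intro exI[of _ C] ballI)
  fix f assume "f \<in> var_Lebesgue \<mu> q"
  then have [measurable]: "f \<in> borel_measurable \<mu>" by (simp add: var_Lebesgue_def)
  let ?N = "var_norm \<mu> q (maximal_fun P \<mu> f)"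
  have "?N / ennreal C \<le> ennreal t"
    if t: "0 < t" "var_modular \<mu> q (\<lambda>x. ennreal \<bar>f x\<bar> / ennreal t) \<le> 1" for t
  proof -
    have "var_modular \<mu> q (\<lambda>x. avg_maximal (\<lambda>x. ennreal \<bar>f x\<bar> / ennreal t) x / ennreal C) \<le> 1"
      using b t unfolding modular_bounded_def by auto
    moreover have "avg_maximal (\<lambda>x. ennreal \<bar>f x\<bar> / ennreal t) x / ennreal C
        = maximal_fun P \<mu> f x / ennreal (C * t)" for x
    proof -
      have "inverse (ennreal (C * t)) = inverse (ennreal t) * inverse (ennreal C)"
        using t C by (simp add: inverse_ennreal mult.commute flip: ennreal_mult)
      then show ?thesis
        by (simp add: avg_maximal_divide maximal_fun_eq) (simp add: divide_ennreal_def mult.assoc)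
    qed
    ultimately have "?N \<le> ennreal (C * t)" using t C by (intro var_norm_le) auto
    then show ?thesis
      using C t by (intro divide_le_posI_ennreal) (auto simp: ennreal_mult)
  qed
  then have "?N / ennreal C \<le> var_norm \<mu> q (\<lambda>x. ennreal \<bar>f x\<bar>)"
    unfolding var_norm_def[of _ _ "\<lambda>x. ennreal \<bar>f x\<bar>"] by (intro Inf_greatest) auto
  then have "ennreal C * (?N / ennreal C) \<le> ennreal C * var_norm \<mu> q (\<lambda>x. ennreal \<bar>f x\<bar>)"
    by (rule mult_left_mono) simp
  moreover have "ennreal C * (?N / ennreal C) = ?N"
    using C by (simp add: ennreal_times_divide mult.commute[of "ennreal C"] ennreal_mult_divide_eq)
  ultimately show "?N \<le> ennreal C * var_norm \<mu> q (\<lambda>x. ennreal \<bar>f x\<bar>)" by simp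
qed

text \<open>The modular of the series is controlled without a triangle inequality: the series lies
  below a supremum of weighted iterates, and the modular of a supremum is at most the sum of the
  modulars.\<close>

lemma rubio_de_francia:
  assumes b: "modular_bounded p A" and A: "1 \<le> A"
    and [measurable]: "p \<in> borel_measurable \<mu>" "g \<in> borel_measurable \<mu>"
    and p: "\<And>x. x \<in> G \<Longrightarrow> 1 \<le> p x" and g: "var_modular \<mu> p g \<le> 1"
  obtains w where "w \<in> borel_measurable \<mu>" "\<And>x. g x \<le> 4 * w x"
    "\<And>x. avg_maximal w x \<le> ennreal (4 * A) * w x" "var_modular \<mu> p w \<le> 1"
proof -
  define u where "u k = ((\<lambda>f x. avg_maximal f x / ennreal A) ^^ k) g" for k
  have u0: "u 0 = g" and uSuc: "u (Suc k) x = avg_maximal (u k) x / ennreal A" for k x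
    by (simp_all add: u_def)
  have u: "u k \<in> borel_measurable \<mu> \<and> var_modular \<mu> p (u k) \<le> 1" for k
  proof (induction k)
    case 0 then show ?case using g by (simp add: u0)
  next
    case (Suc k)
    have "u (Suc k) = (\<lambda>x. avg_maximal (u k) x / ennreal A)" by (simp add: uSuc fun_eq_iff)
    then show ?case using Suc b unfolding modular_bounded_def by auto
  qed
  then have [measurable]: "u k \<in> borel_measurable \<mu>" for k by blast
  define w where "w x = (\<Sum>k. ennreal ((1 / 4) ^ Suc k) * u k x)" for x
  have meas: "w \<in> borel_measurable \<mu>" unfolding w_def by measurable
  have ge: "g x \<le> 4 * w x" for x
  proof -
    have "ennreal (1 / 4) * g x \<le> w x"
      using sum_le_suminf[of "\<lambda>k. ennreal ((1 / 4) ^ Suc k) * u k x" "{0}"] by (simp add: w_def u0)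
    then have "4 * (ennreal (1 / 4) * g x) \<le> 4 * w x" by (rule mult_left_mono) simp
    moreover have "4 * (ennreal (1 / 4) * g x) = g x"
    proof -
      have "(4::ennreal) * ennreal (1 / 4) = 1"
        by (simp flip: ennreal_numeral ennreal_mult)
      then show ?thesis by (simp flip: mult.assoc)
    qed
    ultimately show ?thesis by simp
  qed
  have A1: "avg_maximal w x \<le> ennreal (4 * A) * w x" for x
  proof -
    have "avg_maximal w x \<le> (\<Sum>k. avg_maximal (\<lambda>x. ennreal ((1 / 4) ^ Suc k) * u k x) x)"
      unfolding w_def by (rule avg_maximal_suminf) measurable
    \<comment> \<open>Passing to the next iterate costs \<open>A\<close> from its normalisation and
      4 from the weights.\<close>
    also have "\<dots> = (\<Sum>k. ennreal (4 * A) * (ennreal ((1 / 4) ^ Suc (Suc k)) * u (Suc k) x))"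
    proof (intro suminf_cong)
      fix k
      have "avg_maximal (u k) x = ennreal A * u (Suc k) x"
        using A by (simp add: uSuc ennreal_times_divide mult.commute[of "ennreal A"] ennreal_mult_divide_eq)
      then have "avg_maximal (\<lambda>x. ennreal ((1 / 4) ^ Suc k) * u k x) x
          = (ennreal ((1 / 4) ^ Suc k) * ennreal A) * u (Suc k) x"
        by (subst avg_maximal_cmult) (simp_all add: mult.assoc)
      also have "ennreal ((1 / 4) ^ Suc k) * ennreal A = ennreal (4 * A) * ennreal ((1 / 4) ^ Suc (Suc k))"
        using A by (simp flip: ennreal_mult)
      finally show "avg_maximal (\<lambda>x. ennreal ((1 / 4) ^ Suc k) * u k x) x
          = ennreal (4 * A) * (ennreal ((1 / 4) ^ Suc (Suc k)) * u (Suc k) x)" by (simp only: mult.assoc)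
    qed
    also have "\<dots> = ennreal (4 * A) * (\<Sum>k. ennreal ((1 / 4) ^ Suc (Suc k)) * u (Suc k) x)" by simp
    also have "\<dots> \<le> ennreal (4 * A) * w x"
    proof (rule mult_left_mono)
      show "(\<Sum>k. ennreal ((1 / 4) ^ Suc (Suc k)) * u (Suc k) x) \<le> w x"
        unfolding w_def
        by (subst suminf_offset[where i = 1 and f = "\<lambda>k. ennreal ((1 / 4) ^ Suc k) * u k x"]) auto
    qed simp
    finally show ?thesis .
  qed
  \<comment> \<open>The weights \<open>(1 / 4) ^ Suc k\<close> are the squares of
    \<open>\<theta> k\<close>: one factor sums to one, the other stays with the iterate inside the
    supremum.\<close>
  define \<theta> :: "nat \<Rightarrow> real" where "\<theta> k = (1 / 2) ^ Suc k" for k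
  have \<theta>: "0 \<le> \<theta> k" "\<theta> k \<le> 1" for k
    unfolding \<theta>_def by (simp, rule power_le_one) auto
  have \<theta>sum: "(\<Sum>k. ennreal (\<theta> k)) = 1"
    unfolding \<theta>_def using power_half_series by (intro sums_unique[symmetric] ) (auto simp: sums_ennreal simp flip: ennreal_1)
  have w_le: "w x \<le> (SUP k. ennreal (\<theta> k) * u k x)" for x
  proof -
    have "w x = (\<Sum>k. ennreal (\<theta> k) * (ennreal (\<theta> k) * u k x))"
      unfolding w_def
      by (intro suminf_cong) (simp add: \<theta>_def power_mult_distrib flip: mult.assoc ennreal_mult power_mult_distrib)
    also have "\<dots> \<le> (\<Sum>k. ennreal (\<theta> k) * (SUP k. ennreal (\<theta> k) * u k x))"
      by (intro suminf_le mult_left_mono SUP_upper) auto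
    also have "\<dots> = (SUP k. ennreal (\<theta> k) * u k x)" by (simp add: \<theta>sum)
    finally show ?thesis .
  qed
  have "var_modular \<mu> p w \<le> var_modular \<mu> p (\<lambda>x. SUP k. ennreal (\<theta> k) * u k x)"
    using w_le p by (intro var_modular_mono) (auto simp: space_haar intro: order_trans[OF zero_le_one])
  also have "\<dots> \<le> (\<integral>\<^sup>+x. (\<Sum>k. ennreal_powr (ennreal (\<theta> k) * u k x) (p x)) \<partial>\<mu>)"
    unfolding var_modular_def
  proof (intro nn_integral_mono)
    fix x assume "x \<in> space \<mu>"
    then have "0 < p x" using p[of x] by (simp add: space_haar)
    then have "ennreal_powr (SUP k. ennreal (\<theta> k) * u k x) (p x)
        \<le> (SUP k. ennreal_powr (ennreal (\<theta> k) * u k x) (p x))" by (rule ennreal_powr_SUP)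
    also have "\<dots> \<le> (\<Sum>k. ennreal_powr (ennreal (\<theta> k) * u k x) (p x))"
      using sum_le_suminf[of "\<lambda>k. ennreal_powr (ennreal (\<theta> k) * u k x) (p x)" "{_}"]
      by (intro SUP_least) simp
    finally show "ennreal_powr (SUP k. ennreal (\<theta> k) * u k x) (p x)
        \<le> (\<Sum>k. ennreal_powr (ennreal (\<theta> k) * u k x) (p x))" .
  qed
  also have "\<dots> = (\<Sum>k. var_modular \<mu> p (\<lambda>x. ennreal (\<theta> k) * u k x))"
    unfolding var_modular_def by (rule nn_integral_suminf) measurable
  also have "\<dots> \<le> (\<Sum>k. ennreal (\<theta> k))"
  proof (rule suminf_le)
    fix k
    have "var_modular \<mu> p (\<lambda>x. ennreal (\<theta> k) * u k x) \<le> ennreal (\<theta> k) * var_modular \<mu> p (u k)"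
      using \<theta> p by (intro var_modular_contract) (auto simp: space_haar)
    also have "\<dots> \<le> ennreal (\<theta> k) * 1" using u by (intro mult_left_mono) auto
    finally show "var_modular \<mu> p (\<lambda>x. ennreal (\<theta> k) * u k x) \<le> ennreal (\<theta> k)" by simp
  qed auto
  finally have "var_modular \<mu> p w \<le> 1" by (simp add: \<theta>sum)
  then show thesis using that meas ge A1 by blast
qed

text \<open>The power of the weight is again an \<open>A1\<close> weight. Reverse Hoelder bounds its
  average over an interval by the power of the average of \<open>w\<close>, and the
  \<open>A1\<close> bound turns that into a value at \<open>x\<close>, at the cost
  \<open>K powr (1 + \<delta>)\<close>.\<close>

lemma avg_maximal_powr_weight:
  assumes [measurable]: "w \<in> borel_measurable \<mu>" and K: "1 \<le> K"
    and A1: "\<And>x. avg_maximal w x \<le> ennreal K * w x" and fin: "AE x in \<mu>. w x \<noteq> top"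
    and \<delta>: "0 < \<delta>" "6 * K * \<delta> \<le> 1"
  shows "avg_maximal (\<lambda>x. ennreal_powr (w x) (1 + \<delta>)) x
    \<le> ennreal (2 * K * K powr (1 + \<delta>)) * ennreal_powr (w x) (1 + \<delta>)"
proof -
  have av: "(\<integral>\<^sup>+x\<in>arc_of t. w x \<partial>\<mu>) / emeasure \<mu> (arc_of t) \<le> ennreal K * w x"
    if "t \<in> indices" "x \<in> arc_of t" for t x
    using average_le_avg_maximal[of "arc_of t" x w] A1[of x] that
    by (auto simp: gen_intervals_eq_image intro: order_trans)
  have wfin: "(\<integral>\<^sup>+x\<in>arc_of t. w x \<partial>\<mu>) \<noteq> top" if t: "t \<in> indices" for t
  proof
    \<comment> \<open>An infinite integral would force \<open>w\<close> to be infinite on the whole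
      arc, which has positive measure.\<close>
    assume inf: "(\<integral>\<^sup>+x\<in>arc_of t. w x \<partial>\<mu>) = top"
    have [measurable]: "arc_of t \<in> sets \<mu>" by (rule sets_D[OF t])
    have "AE x in \<mu>. x \<notin> arc_of t"
      using fin
    proof eventually_elim
      case (elim x)
      show ?case
      proof
        assume "x \<in> arc_of t"
        from av[OF t this] have "ennreal K * w x = top"
          using emeasure_haar_finite[of "arc_of t"]
          by (simp add: inf ennreal_top_divide top_unique)
        then show False using elim by (simp add: ennreal_mult_eq_top_iff)
      qed
    qed
    moreover have "{x \<in> space \<mu>. \<not> x \<notin> arc_of t} = arc_of t"
      using sets.sets_into_space[OF sets_D[OF t]] by auto
    ultimately have "emeasure \<mu> (arc_of t) = 0"
      by (rule AE_iff_measurable[OF sets_D[OF t], THEN iffD1, rotated])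
    then show False using D_pos[OF t] by (simp add: measure_def)
  qed
  interpret A1_weight \<mu> indices arc_of left_half right_half w K
    by unfold_locales (use K wfin av in auto)
  show ?thesis
  proof (rule avg_maximal_leI)
    fix I assume "I \<in> gen_intervals P" "x \<in> I"
    then obtain t where t: "t \<in> indices" "I = arc_of t" "x \<in> arc_of t"
      by (auto simp: gen_intervals_eq_image)
    have \<mu>I: "emeasure \<mu> (arc_of t) \<noteq> 0" "emeasure \<mu> (arc_of t) \<noteq> top"
      using D_pos[OF t(1)] emeasure_haar_finite by (auto simp: measure_def)
    let ?s = "1 + \<delta>"
    have "(\<integral>\<^sup>+x\<in>arc_of t. ennreal_powr (w x) ?s \<partial>\<mu>) \<le> ennreal (2 * K) *
        ennreal_powr ((\<integral>\<^sup>+x\<in>arc_of t. w x \<partial>\<mu>) / emeasure \<mu> (arc_of t)) ?s * emeasure \<mu> (arc_of t)"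
      by (rule reverse_Holder[OF \<delta> t(1)]) (rule outer_approximation[OF t(1)])
    also have "\<dots> \<le> ennreal (2 * K) * ennreal_powr (ennreal K * w x) ?s * emeasure \<mu> (arc_of t)"
      using \<delta> by (intro mult_right_mono mult_left_mono ennreal_powr_mono av t) auto
    also have "ennreal_powr (ennreal K * w x) ?s = ennreal (K powr ?s) * ennreal_powr (w x) ?s"
      using K \<delta> by (simp add: ennreal_powr_mult ennreal_powr_ennreal)
    finally have "(\<integral>\<^sup>+x\<in>arc_of t. ennreal_powr (w x) ?s \<partial>\<mu>) \<le>
        (ennreal (2 * K * K powr ?s) * ennreal_powr (w x) ?s) * emeasure \<mu> (arc_of t)"
      using K by (simp add: ennreal_mult mult.assoc)
    then have "(\<integral>\<^sup>+x\<in>arc_of t. ennreal_powr (w x) ?s \<partial>\<mu>) / emeasure \<mu> (arc_of t) \<le>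
        (ennreal (2 * K * K powr ?s) * ennreal_powr (w x) ?s) * emeasure \<mu> (arc_of t) / emeasure \<mu> (arc_of t)"
      by (rule divide_right_mono_ennreal)
    also have "\<dots> = ennreal (2 * K * K powr ?s) * ennreal_powr (w x) ?s"
      using \<mu>I by (intro ennreal_mult_divide_eq)
    finally show "(\<integral>\<^sup>+x\<in>I. ennreal_powr (w x) ?s \<partial>\<mu>) / emeasure \<mu> I \<le>
        ennreal (2 * K * K powr ?s) * ennreal_powr (w x) ?s" by (simp add: t(2))
  qed
qed

section \<open>Change of exponent and the two implications\<close>

lemma var_modular_powr_exponent:
  "var_modular \<mu> q (\<lambda>x. ennreal_powr (f x) r) = var_modular \<mu> (\<lambda>x. r * q x) f"
  by (simp add: var_modular_def ennreal_powr_powr)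

text \<open>With \<open>s = 1 + \<delta>\<close> and \<open>f\<close> the power \<open>s\<close> of
  \<open>g\<close>, a weight \<open>w\<close> for \<open>g\<close> gives a majorant of
  \<open>avg_maximal f\<close> proportional to the power \<open>s\<close> of \<open>w\<close>. Its
  modular for the exponent \<open>p / s\<close> is the modular of \<open>w\<close> for
  \<open>p\<close>.\<close>

lemma modular_bounded_self_improves:
  assumes b: "modular_bounded p A" and A: "1 \<le> A"
    and [measurable]: "p \<in> borel_measurable \<mu>" and p: "\<And>x. x \<in> G \<Longrightarrow> 1 \<le> p x"
    and \<delta>: "0 < \<delta>" "24 * A * \<delta> \<le> 1"
  shows "\<exists>C>0. modular_bounded (\<lambda>x. 1 / (1 + \<delta>) * p x) C"
proof -
  define s where "s = 1 + \<delta>"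
  have s: "0 < s" "1 / s * s = 1" using \<delta> by (auto simp: s_def)
  define K where "K = 4 * A"
  \<comment> \<open>The first factor comes from \<open>g \<le> 4 * w\<close>, the second from
    \<open>avg_maximal_powr_weight\<close>.\<close>
  define C where "C = 4 powr s * (2 * K * K powr s)"
  have K: "1 \<le> K" "6 * K * \<delta> \<le> 1" using A \<delta> by (auto simp: K_def)
  have C: "0 < C" using K by (simp add: C_def)
  have "modular_bounded (\<lambda>x. 1 / s * p x) C"
    unfolding modular_bounded_def
  proof (intro ballI impI)
    fix f assume [measurable]: "f \<in> borel_measurable \<mu>" and f: "var_modular \<mu> (\<lambda>x. 1 / s * p x) f \<le> 1"
    define g where "g x = ennreal_powr (f x) (1 / s)" for x
    have [measurable]: "g \<in> borel_measurable \<mu>" unfolding g_def by measurable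
    have fg: "f x = ennreal_powr (g x) s" for x using s by (simp add: g_def ennreal_powr_powr)
    have "var_modular \<mu> p g \<le> 1" using f unfolding g_def[abs_def] var_modular_powr_exponent .
    then obtain w where [measurable]: "w \<in> borel_measurable \<mu>" and w: "\<And>x. g x \<le> 4 * w x"
      "\<And>x. avg_maximal w x \<le> ennreal K * w x" "var_modular \<mu> p w \<le> 1"
      unfolding K_def using rubio_de_francia[OF b A _ _ p] by (metis assms(3) \<open>g \<in> borel_measurable \<mu>\<close>)
    have wfin: "AE x in \<mu>. w x \<noteq> top"
      using w(3) by (intro var_modular_finite_AE[of w \<mu> p 1]) auto
    have "avg_maximal f x \<le> ennreal C * ennreal_powr (w x) s" for x
    proof -
      have "avg_maximal f x \<le> avg_maximal (\<lambda>x. ennreal (4 powr s) * ennreal_powr (w x) s) x"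
      proof (rule avg_maximal_mono)
        fix y
        have "f y \<le> ennreal_powr (4 * w y) s" unfolding fg using s w(1) by (intro ennreal_powr_mono) auto
        also have "\<dots> = ennreal (4 powr s) * ennreal_powr (w y) s"
          using s by (simp add: ennreal_powr_mult ennreal_powr_ennreal flip: ennreal_numeral)
        finally show "f y \<le> ennreal (4 powr s) * ennreal_powr (w y) s" .
      qed
      also have "\<dots> = ennreal (4 powr s) * avg_maximal (\<lambda>x. ennreal_powr (w x) s) x"
        by (rule avg_maximal_cmult) measurable
      also have "\<dots> \<le> ennreal (4 powr s) * (ennreal (2 * K * K powr s) * ennreal_powr (w x) s)"
        unfolding s_def by (intro mult_left_mono avg_maximal_powr_weight K w wfin \<delta>) auto
      also have "\<dots> = ennreal C * ennreal_powr (w x) s"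
        using K by (simp add: C_def ennreal_mult mult.assoc)
      finally show ?thesis .
    qed
    then have le: "avg_maximal f x / ennreal C \<le> ennreal_powr (w x) s" for x
      using C by (intro divide_le_posI_ennreal) auto
    have "var_modular \<mu> (\<lambda>x. 1 / s * p x) (\<lambda>x. avg_maximal f x / ennreal C)
        \<le> var_modular \<mu> (\<lambda>x. 1 / s * p x) (\<lambda>x. ennreal_powr (w x) s)"
      using le s p by (intro var_modular_mono)
        (auto simp: space_haar intro!: divide_nonneg_pos intro: order_trans[OF zero_le_one])
    also have "\<dots> = var_modular \<mu> p w"
      using s by (simp add: var_modular_def ennreal_powr_powr)
    also have "\<dots> \<le> 1" by (rule w(3))
    finally show "var_modular \<mu> (\<lambda>x. 1 / s * p x) (\<lambda>x. avg_maximal f x / ennreal C) \<le> 1" .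
  qed
  then show ?thesis using C unfolding s_def by blast
qed

text \<open>Substituting the power \<open>1 / r\<close> of \<open>g\<close> moves the problem to the
  exponent \<open>r * p\<close>, and \<open>avg_maximal_le_powr\<close> compares the two maximal
  functions. The constant \<open>C\<close> leaves the power as \<open>C powr r\<close>.\<close>

lemma modular_bounded_upward:
  assumes b: "modular_bounded (\<lambda>x. r * p x) C" and C: "0 < C" and r: "0 < r" "r \<le> 1"
    and p: "\<And>x. x \<in> G \<Longrightarrow> 0 \<le> p x"
  shows "modular_bounded p (2 * C powr r)"
  unfolding modular_bounded_def
proof (intro ballI impI)
  fix g assume [measurable]: "g \<in> borel_measurable \<mu>" and g: "var_modular \<mu> p g \<le> 1"
  define f where "f x = ennreal_powr (g x) (1 / r)" for x
  have [measurable]: "f \<in> borel_measurable \<mu>" unfolding f_def by measurable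
  have "var_modular \<mu> (\<lambda>x. r * p x) f = var_modular \<mu> p g"
    using r by (simp add: f_def var_modular_def ennreal_powr_powr)
  then have bf: "var_modular \<mu> (\<lambda>x. r * p x) (\<lambda>x. avg_maximal f x / ennreal C) \<le> 1"
    using b g unfolding modular_bounded_def by auto
  have "avg_maximal g x / ennreal (2 * C powr r) \<le> ennreal_powr (avg_maximal f x / ennreal C) r" for x
  proof (rule divide_le_posI_ennreal)
    have "avg_maximal g x \<le> 2 * ennreal_powr (avg_maximal f x) r"
      using avg_maximal_le_powr[of "1 / r" g x] r unfolding f_def by simp
    also have "ennreal_powr (avg_maximal f x) r = ennreal_powr (ennreal C * (avg_maximal f x / ennreal C)) r"
      using C by (simp add: ennreal_times_divide mult.commute[of "ennreal C"] ennreal_mult_divide_eq)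
    also have "2 * \<dots> = ennreal (2 * C powr r) * ennreal_powr (avg_maximal f x / ennreal C) r"
      using C r by (simp add: ennreal_powr_mult ennreal_powr_ennreal ennreal_mult mult.assoc)
    finally show "avg_maximal g x \<le> ennreal (2 * C powr r) * ennreal_powr (avg_maximal f x / ennreal C) r" .
  qed (use C in simp)
  then have "var_modular \<mu> p (\<lambda>x. avg_maximal g x / ennreal (2 * C powr r))
      \<le> var_modular \<mu> p (\<lambda>x. ennreal_powr (avg_maximal f x / ennreal C) r)"
    using p by (intro var_modular_mono) (auto simp: space_haar)
  also have "\<dots> \<le> 1" using bf by (simp add: var_modular_powr_exponent)
  finally show "var_modular \<mu> p (\<lambda>x. avg_maximal g x / ennreal (2 * C powr r)) \<le> 1" .
qed

end

theorem theorem1p8: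
  fixes P :: "nat \<Rightarrow> nat"
    and \<mu> :: "(nat \<Rightarrow> int) measure"
    and p :: "(nat \<Rightarrow> int) \<Rightarrow> real"
  assumes "\<And>i. 2 \<le> P i"
    and "normalized_haar P \<mu>"
    and "p \<in> borel_measurable \<mu>"
    and "\<And>x. x \<in> carrier (vgroup P) \<Longrightarrow> 1 \<le> p x"
    and "1 < essinf \<mu> (\<lambda>x. ereal (p x))"
    and "essinf \<mu> (\<lambda>x. ereal (p x)) \<le> esssup \<mu> (\<lambda>x. ereal (p x))"
    and "esssup \<mu> (\<lambda>x. ereal (p x)) < \<infinity>"
  shows "maximal_bounded_on P \<mu> p \<longleftrightarrow>
         (\<exists>r0. 0 < r0 \<and> r0 < 1 \<and>
            (\<forall>r. r0 < r \<and> r < 1 \<longrightarrow> maximal_bounded_on P \<mu> (\<lambda>x. r * p x)))"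
proof -
  interpret vilenkin_haar P \<mu> using assms(1,2) by unfold_locales
  note [measurable] = assms(3)
  have p0: "0 \<le> p x" if "x \<in> G" for x using assms(4)[OF that] by simp
  show ?thesis
  proof
    assume "maximal_bounded_on P \<mu> p"
    then obtain A where A: "1 \<le> A" "modular_bounded p A"
      using maximal_bounded_on_imp_modular_bounded[of p] p0 assms(3) by blast
    \<comment> \<open>Chosen so that \<open>r0 < r\<close> says
      \<open>1 / r - 1 < 1 / (24 * A)\<close>, the admissible range of
      \<open>\<delta>\<close>.\<close>
    define r0 where "r0 = 1 / (1 + 1 / (24 * A))"
    have "maximal_bounded_on P \<mu> (\<lambda>x. r * p x)" if r: "r0 < r" "r < 1" for r
    proof -
      have r_pos: "0 < r" using r(1) A by (intro less_trans[OF _ r(1)]) (simp add: r0_def add_pos_pos)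
      define \<delta> where "\<delta> = 1 / r - 1"
      have "0 < \<delta>" using r r_pos by (simp add: \<delta>_def)
      have "1 / r < 1 / r0" using r A by (intro divide_strict_left_mono) (auto simp: r0_def add_pos_pos r_pos)
      then have "\<delta> \<le> 1 / (24 * A)" by (simp add: \<delta>_def r0_def)
      then have "24 * A * \<delta> \<le> 1" using A by (simp add: field_simps)
      moreover have "1 / (1 + \<delta>) = r" by (simp add: \<delta>_def)
      ultimately obtain C where "0 < C" "modular_bounded (\<lambda>x. r * p x) C"
        using modular_bounded_self_improves[OF A(2,1) assms(3,4) \<open>0 < \<delta>\<close>] by auto
      then show ?thesis by (intro modular_bounded_imp_maximal_bounded_on)
    qed
    moreover have "0 < r0" "r0 < 1" using A by (auto simp: r0_def add_pos_pos)
    ultimately show "\<exists>r0. 0 < r0 \<and> r0 < 1 \<and>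
            (\<forall>r. r0 < r \<and> r < 1 \<longrightarrow> maximal_bounded_on P \<mu> (\<lambda>x. r * p x))" by blast
  next
    assume "\<exists>r0. 0 < r0 \<and> r0 < 1 \<and>
            (\<forall>r. r0 < r \<and> r < 1 \<longrightarrow> maximal_bounded_on P \<mu> (\<lambda>x. r * p x))"
    then obtain r0 where r0: "0 < r0" "r0 < 1"
      "\<And>r. r0 < r \<Longrightarrow> r < 1 \<Longrightarrow> maximal_bounded_on P \<mu> (\<lambda>x. r * p x)" by blast
    \<comment> \<open>Boundedness for a single \<open>r\<close> is enough; the midpoint is one
      choice in the interval.\<close>
    define r where "r = (r0 + 1) / 2"
    have r: "r0 < r" "r < 1" "0 < r" using r0 by (auto simp: r_def)
    obtain C where C: "1 \<le> C" "modular_bounded (\<lambda>x. r * p x) C"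
      using maximal_bounded_on_imp_modular_bounded[OF r0(3)[OF r(1,2)]] p0 r(3) by auto
    have "modular_bounded p (2 * C powr r)"
      using C r p0 by (intro modular_bounded_upward) auto
    then show "maximal_bounded_on P \<mu> p"
      using C by (intro modular_bounded_imp_maximal_bounded_on) auto
  qed
qed

end
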